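(* Let $X\subset\mathbb R^2$, $Y=(a,b)$, $c$, $L_x(y)$, $P$, the notion "splits the mass" and the MCP be as in the context. Let $\mu$ and $\nu$ be Borel probability measures on $X$ and $Y$ that are absolutely continuous with respect to Lebesgue measure. Suppose that for all $(x,y)\in\overline X\times\overline Y$ such that $y$ splits the mass at $x$ there exists an $\tilde x\in P\cap L_x(y)$ satisfying the MCP. Then the optimal map is continuous on $\overline X$.
   Context: $Y=(a,b)\subset\mathbb R$ is an open interval and $X$ is a bounded domain in $\mathbb R^2$; the closures $\overline X$, $\overline Y$ are compact. The cost $c\in C^2(\overline X\times\overline Y)$ is such that the gradient $\nabla_x\big(\frac{\partial c}{\partial y}\big)(x,y)$ does not vanish for any $x\in X$, $y\in Y$. The level set through $x$ is $L_x(y):=\{\overline x\in X:\frac{\partial c(\overline x,y)}{\partial y}=\frac{\partial c(x,y)}{\partial y}\}$; the same formula is used when $x$ or $y$ is a point of $\overline X$ or $\overline Y$. $P$ is the set of $\tilde x\in\overline X$ such that for all $y_0<y_1$ in $Y$ and all $x\in L_{\tilde x}(y_0)$ we have $\frac{\partial c(\tilde x,y_1)}{\partial y}\le\frac{\partial c(x,y_1)}{\partial y}$. $y$ splits the mass at $x$ if $\mu\big(\{\overline x:\frac{\partial c(x,y)}{\partial y}<\frac{\partial c(\overline x,y)}{\partial y}\}\big)=\nu([a,y))$. $\tilde x\in P$ satisfies the mass comparison property (MCP) if for all $y_0<y_1$ in $Y$, $\mu\big(\bigcup_{y\in[y_0,y_1]}L_{\tilde x}(y)\big)<\nu([y_0,y_1])$.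 The Kantorovich problem is to minimize $\int_{X\times Y}c\,d\gamma$ over Borel probability measures $\gamma$ on $X\times Y$ with marginals $\mu$ and $\nu$; let $\gamma$ be a solution. $spt(\gamma)$ is the smallest closed subset of $X\times Y$ of full $\gamma$-mass. It is a theorem of the paper that under the hypotheses of the claim, for each $x\in\overline X$ there is a unique $y\in\overline Y$ that splits the mass at $x$, and that this $y$ is the only point of $\overline Y$ with $(x,y)\in spt(\gamma)$; the optimal map $F$ (the map pushing $\mu$ forward to $\nu$ that minimizes $\int_Xc(x,F(x))\,d\mu$) is thereby defined everywhere on $\overline X$ by $F(x):=y$.
   Formalization: Unique splitting on the closure of Y can fail at endpoints (c_y=y(1-y)x_1 on the unit square), so F(x) must split the mass unless F(x)=b, splitting points are unique only in (a,b), and F(x) is the only y that can have (x,y) in spt(γ); F is shown to exist, be optimal and be continuous. *)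

theory Defs
  imports "HOL-Probability.Probability"
begin

text \<open>
  Throughout, \<open>X\<close> is a subset of the plane, \<open>Y = {a<..<b}\<close>, and the cost is an uncurried function
  \<open>c\<close> on the product; only its values on \<open>closure X \<times> {a..b}\<close> matter.
\<close>

text \<open>
  \<open>f \<in> C\<^sup>2(closure U)\<close> for an open \<open>U\<close>: \<open>f\<close> is twice differentiable in \<open>U\<close>, and \<open>f\<close> and its first
  two derivatives extend continuously to the closure.
\<close>
definition C2_closure :: "'a::euclidean_space set \<Rightarrow> ('a \<Rightarrow> real) \<Rightarrow> bool" where
  "C2_closure U f \<longleftrightarrow>
     (\<exists>(f' :: 'a \<Rightarrow> 'a \<Rightarrow>\<^sub>L real) (f'' :: 'a \<Rightarrow> 'a \<Rightarrow>\<^sub>L 'a \<Rightarrow>\<^sub>L real).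
        (\<forall>z\<in>U. (f has_derivative blinfun_apply (f' z)) (at z)) \<and>
        (\<forall>z\<in>U. (f' has_derivative blinfun_apply (f'' z)) (at z)) \<and>
        continuous_on (closure U) f \<and>
        continuous_on (closure U) f' \<and>
        continuous_on (closure U) f'')"

text \<open>
  The partial derivative in \<open>y\<close>, one-sided at the endpoints. For \<open>c \<in> C\<^sup>2\<close> of the closure, it is
  on all of \<open>closure X \<times> {a..b}\<close> the continuous extension of the partial derivative inside.
\<close>
definition cost_y :: "real \<Rightarrow> real \<Rightarrow> ((real^2) \<times> real \<Rightarrow> real) \<Rightarrow> real^2 \<Rightarrow> real \<Rightarrow> real" where
  "cost_y a b c x y = vector_derivative (\<lambda>t. c (x, t)) (at y within {a..b})"

definition level_set ::
  "(real^2) set \<Rightarrow> real \<Rightarrow> real \<Rightarrow> ((real^2) \<times> real \<Rightarrow> real) \<Rightarrow> real^2 \<Rightarrow> real \<Rightarrow> (real^2) set" where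
  "level_set X a b c x y = {x' \<in> X. cost_y a b c x' y = cost_y a b c x y}"

definition P_set ::
  "(real^2) set \<Rightarrow> real \<Rightarrow> real \<Rightarrow> ((real^2) \<times> real \<Rightarrow> real) \<Rightarrow> (real^2) set" where
  "P_set X a b c =
     {xt \<in> closure X. \<forall>y\<^sub>0\<in>{a<..<b}. \<forall>y\<^sub>1\<in>{a<..<b}. y\<^sub>0 < y\<^sub>1 \<longrightarrow>
        (\<forall>x\<in>level_set X a b c xt y\<^sub>0. cost_y a b c xt y\<^sub>1 \<le> cost_y a b c x y\<^sub>1)}"

text \<open>
  A Borel probability measure on \<open>A\<close> is encoded as a Borel probability measure on the ambient space
  that gives \<open>A\<close> full mass.
\<close>
definition borel_prob_on :: "'a::topological_space set \<Rightarrow> 'a measure \<Rightarrow> bool" where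
  "borel_prob_on A M \<longleftrightarrow> prob_space M \<and> sets M = sets borel \<and> emeasure M A = 1"

definition splits_mass ::
  "(real^2) set \<Rightarrow> real \<Rightarrow> real \<Rightarrow> ((real^2) \<times> real \<Rightarrow> real) \<Rightarrow> (real^2) measure \<Rightarrow> real measure
     \<Rightarrow> real^2 \<Rightarrow> real \<Rightarrow> bool" where
  "splits_mass X a b c \<mu> \<nu> x y \<longleftrightarrow>
     measure \<mu> {x' \<in> X. cost_y a b c x y < cost_y a b c x' y} = measure \<nu> {a..<y}"

definition mass_comparison ::
  "(real^2) set \<Rightarrow> real \<Rightarrow> real \<Rightarrow> ((real^2) \<times> real \<Rightarrow> real) \<Rightarrow> (real^2) measure \<Rightarrow> real measure
     \<Rightarrow> real^2 \<Rightarrow> bool" where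
  "mass_comparison X a b c \<mu> \<nu> xt \<longleftrightarrow>
     (\<forall>y\<^sub>0\<in>{a<..<b}. \<forall>y\<^sub>1\<in>{a<..<b}. y\<^sub>0 < y\<^sub>1 \<longrightarrow>
        measure \<mu> (\<Union>y\<in>{y\<^sub>0..y\<^sub>1}. level_set X a b c xt y) < measure \<nu> {y\<^sub>0..y\<^sub>1})"

definition couplings ::
  "(real^2) set \<Rightarrow> real \<Rightarrow> real \<Rightarrow> (real^2) measure \<Rightarrow> real measure \<Rightarrow> ((real^2) \<times> real) measure set"
  where
  "couplings X a b \<mu> \<nu> =
     {\<gamma>. borel_prob_on (X \<times> {a<..<b}) \<gamma> \<and> distr \<gamma> borel fst = \<mu> \<and> distr \<gamma> borel snd = \<nu>}"

definition kantorovich_solution ::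
  "(real^2) set \<Rightarrow> real \<Rightarrow> real \<Rightarrow> ((real^2) \<times> real \<Rightarrow> real) \<Rightarrow> (real^2) measure \<Rightarrow> real measure
     \<Rightarrow> ((real^2) \<times> real) measure \<Rightarrow> bool" where
  "kantorovich_solution X a b c \<mu> \<nu> \<gamma> \<longleftrightarrow>
     \<gamma> \<in> couplings X a b \<mu> \<nu> \<and>
     (\<forall>\<gamma>'\<in>couplings X a b \<mu> \<nu>.
        (LINT z:(X \<times> {a<..<b})|\<gamma>. c z) \<le> (LINT z:(X \<times> {a<..<b})|\<gamma>'. c z))"

text \<open>
  The support, taken closed in the ambient space, so that it makes sense to ask whether a point of
  \<open>closure X \<times> {a..b}\<close> belongs to it.
\<close>
definition spt :: "'a::topological_space measure \<Rightarrow> 'a set" where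
  "spt M = \<Inter>{S. closed S \<and> emeasure M S = emeasure M (space M)}"

definition transport_maps ::
  "(real^2) set \<Rightarrow> real \<Rightarrow> real \<Rightarrow> (real^2) measure \<Rightarrow> real measure \<Rightarrow> (real^2 \<Rightarrow> real) set" where
  "transport_maps X a b \<mu> \<nu> =
     {G. G \<in> borel_measurable borel \<and> (\<forall>x\<in>X. G x \<in> {a..b}) \<and> distr \<mu> borel G = \<nu>}"

definition monge_optimal ::
  "(real^2) set \<Rightarrow> real \<Rightarrow> real \<Rightarrow> ((real^2) \<times> real \<Rightarrow> real) \<Rightarrow> (real^2) measure \<Rightarrow> real measure
     \<Rightarrow> (real^2 \<Rightarrow> real) \<Rightarrow> bool" where
  "monge_optimal X a b c \<mu> \<nu> F \<longleftrightarrow>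
     F \<in> transport_maps X a b \<mu> \<nu> \<and>
     (\<forall>G\<in>transport_maps X a b \<mu> \<nu>. (LINT x:X|\<mu>. c (x, F x)) \<le> (LINT x:X|\<mu>. c (x, G x)))"

text \<open>
  The optimal map, defined everywhere on \<open>closure X\<close>: \<open>F x\<close> is the point that splits the mass at
  \<open>x\<close>, and the only one that the support of an optimal plan can pair with \<open>x\<close>.

  The endpoints need care, because the gradient of \<open>cost_y\<close> in \<open>x\<close> may vanish there, so that a level
  set can carry mass. For \<open>X\<close> the open unit square with the uniform measure, \<open>Y = {0<..<1}\<close> with the
  uniform measure and \<open>cost_y (x, y) = y (1 - y) x\<^sub>1\<close>, the optimal map is \<open>F x = 1 - x\<^sub>1\<close>; but
  \<open>y = 0\<close> splits the mass at every \<open>x\<close>, and \<open>y = 1\<close> at none. Hence uniqueness of the splitting point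
  is required in the open interval, and \<open>F x\<close> is required to split unless it is \<open>b\<close>.
\<close>
definition optimal_map_on_closure ::
  "(real^2) set \<Rightarrow> real \<Rightarrow> real \<Rightarrow> ((real^2) \<times> real \<Rightarrow> real) \<Rightarrow> (real^2) measure \<Rightarrow> real measure
     \<Rightarrow> (real^2 \<Rightarrow> real) \<Rightarrow> bool" where
  "optimal_map_on_closure X a b c \<mu> \<nu> F \<longleftrightarrow>
     monge_optimal X a b c \<mu> \<nu> F \<and>
     (\<forall>x\<in>closure X.
        F x \<in> {a..b} \<and>
        (F x \<noteq> b \<longrightarrow> splits_mass X a b c \<mu> \<nu> x (F x)) \<and>
        (\<forall>y\<in>{a<..<b}. splits_mass X a b c \<mu> \<nu> x y \<longrightarrow> y = F x) \<and>
        (\<forall>\<gamma>. kantorovich_solution X a b c \<mu> \<nu> \<gamma> \<longrightarrow>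
             (\<forall>y\<in>{a..b}. (x, y) \<in> spt \<gamma> \<longrightarrow> y = F x)))"

end

theory Submission
  imports Defs
begin

text \<open>
  Write \<open>g = cost_y a b c\<close> and let \<open>excess x y\<close> be the difference of the two masses that have to
  agree for \<open>y\<close> to split the mass at \<open>x\<close>. For \<open>y\<close> in the open interval, \<open>excess x y\<close> is continuous in
  both variables and nonincreasing in \<open>g x y\<close>. The crux is that, for every \<open>x \<in> closure X\<close>,
  \<open>excess x\<close> changes sign at most once, strictly from positive to negative. Otherwise
  \<open>excess x y \<le> 0 \<le> excess x y'\<close> for some \<open>y < y'\<close>. For \<open>m\<close> strictly between \<open>y\<close> and \<open>y'\<close>
  there is \<open>z \<in> P\<close> with the MCP and \<open>excess z m = 0\<close>; the MCP makes \<open>excess z\<close> strictly decreasing, so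
  \<open>g z y < g x y\<close> and \<open>g x y' < g z y'\<close>. These strict inequalities survive moving \<open>x\<close> into \<open>X\<close>,
  where the crossing in between contradicts \<open>z \<in> P\<close>. This argument needs no separate treatment of
  boundary points.

  The map \<open>F\<close> sends \<open>x\<close> to the point where the sign changes, so \<open>y < F x\<close> iff \<open>excess x y > 0\<close> and
  \<open>F x < y\<close> iff \<open>excess x y < 0\<close>; continuity of \<open>F\<close> follows from that of \<open>excess\<close>. For optimality,
  let \<open>kappa t\<close> be a threshold of \<open>g x t\<close> that separates \<open>t < F x\<close> from \<open>F x < t\<close>. Its primitive
  \<open>K\<close> is a Kantorovich potential: \<open>c (x, y) - K y\<close> has its only minimum over \<open>y\<close> at \<open>F x\<close>.
\<close>

section \<open>Null level sets and positive integrals\<close>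

text \<open>Where component \<open>i\<close> of the gradient is nonzero, replacing coordinate
  \<open>i\<close> of \<open>x\<close> by \<open>u x\<close> gives a map with injective derivative
  that sends the level set into a hyperplane. Preimages of negligible sets under such maps are
  negligible, and finitely many \<open>i\<close> cover \<open>S\<close>.\<close>

lemma negligible_level_set_gradient:
  fixes u :: "'a::euclidean_space \<Rightarrow> real"
  assumes grad: "\<And>x. x \<in> S \<Longrightarrow> \<exists>D. (GDERIV u x :> D) \<and> D \<noteq> 0"
  shows "negligible {x \<in> S. u x = k}"
proof -
  obtain D where D: "\<And>x. x \<in> S \<Longrightarrow> (GDERIV u x :> D x) \<and> D x \<noteq> 0"
    using grad by metis
  have "negligible {x \<in> {x \<in> S. D x \<bullet> i \<noteq> 0}. x + (u x - x \<bullet> i) *\<^sub>R i \<in> {z. z \<bullet> i = k}}"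
    if i: "i \<in> Basis" for i
  proof (rule negligible_differentiable_vimage)
    show "negligible {z. z \<bullet> i = k}"
      using negligible_standard_hyperplane[OF i] .
  next
    fix x assume x: "x \<in> {x \<in> S. D x \<bullet> i \<noteq> 0}"
    then have "(u has_derivative (\<lambda>h. h \<bullet> D x)) (at x)"
      using D[of x] by (simp add: gderiv_def)
    from has_derivative_at_withinI[OF this]
    show der: "((\<lambda>x. x + (u x - x \<bullet> i) *\<^sub>R i) has_derivative
        (\<lambda>h. h + (h \<bullet> D x - h \<bullet> i) *\<^sub>R i)) (at x within {x \<in> S. D x \<bullet> i \<noteq> 0})"
      by (auto intro!: derivative_eq_intros)
    have "h = 0" if "h + (h \<bullet> D x - h \<bullet> i) *\<^sub>R i = 0" for h
    proof -
      have "(h + (h \<bullet> D x - h \<bullet> i) *\<^sub>R i) \<bullet> i = h \<bullet> D x"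
        using i by (simp add: inner_add_left)
      then have "h \<bullet> D x = 0" using that by simp
      then have h: "h = (h \<bullet> i) *\<^sub>R i" using that by simp
      then have "h \<bullet> D x = (h \<bullet> i) * (D x \<bullet> i)"
        by (metis inner_commute inner_scaleR_left)
      with \<open>h \<bullet> D x = 0\<close> x have "h \<bullet> i = 0" by simp
      with h show "h = 0" by simp
    qed
    then show "inj (\<lambda>h. h + (h \<bullet> D x - h \<bullet> i) *\<^sub>R i)"
      using linear_injective_0[OF has_derivative_linear[OF der]] by blast
  qed
  then have "negligible (\<Union>i\<in>Basis. {x \<in> {x \<in> S. D x \<bullet> i \<noteq> 0}. x + (u x - x \<bullet> i) *\<^sub>R i \<in> {z. z \<bullet> i = k}})"
    by (intro negligible_Union) auto
  moreover have "{x \<in> S. u x = k} \<subseteq> \<dots>"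
  proof
    fix x assume x: "x \<in> {x \<in> S. u x = k}"
    with D obtain i where i: "i \<in> Basis" "D x \<bullet> i \<noteq> 0"
      by (metis (mono_tags, lifting) euclidean_all_zero_iff mem_Collect_eq)
    with x show "x \<in> (\<Union>i\<in>Basis. {x \<in> {x \<in> S. D x \<bullet> i \<noteq> 0}. x + (u x - x \<bullet> i) *\<^sub>R i \<in> {z. z \<bullet> i = k}})"
      by (auto simp: inner_add_left intro!: bexI[of _ i])
  qed
  ultimately show ?thesis by (rule negligible_subset)
qed

lemma right_approaching_sequence:
  fixes l u :: real
  assumes "l < u"
  obtains \<eta> where "\<And>n::nat. \<eta> n \<in> {l<..<u}" "\<eta> \<longlonglongrightarrow> l"
proof -
  have "l \<in> closure {l<..<u}" using assms by simp
  then have "\<exists>\<eta>. (\<forall>n. \<eta> n \<in> {l<..<u}) \<and> \<eta> \<longlonglongrightarrow> l" by (simp only: closure_sequential)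
  then show ?thesis using that by blast
qed

text \<open>Positivity is asked only inside the interval because the integrands used later,
  differences of \<open>g x\<close> and \<open>kappa\<close>, have a known strict sign only away
  from \<open>F x\<close>, \<open>a\<close> and \<open>b\<close>.\<close>

lemma set_lebesgue_integral_Icc_pos:
  fixes u :: "real \<Rightarrow> real"
  assumes "p < q" and int: "set_integrable lborel {p..q} u"
    and pos: "\<And>t. t \<in> {p<..<q} \<Longrightarrow> 0 < u t"
  shows "0 < (LINT t:{p..q}|lborel. u t)"
proof -
  let ?f = "\<lambda>t. indicator {p..q} t *\<^sub>R u t"
  have int': "integrable lborel ?f" using int by (simp add: set_integrable_def)
  have nonneg: "AE t in lborel. 0 \<le> ?f t"
    using AE_lborel_singleton[of p] AE_lborel_singleton[of q]
  proof eventually_elim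
    case (elim t)
    then show ?case using pos[of t] by (auto simp: indicator_def)
  qed
  have "(LINT t|lborel. ?f t) \<noteq> 0"
  proof
    assume "(LINT t|lborel. ?f t) = 0"
    then have "AE t in lborel. ?f t = 0"
      using integral_nonneg_eq_0_iff_AE[OF int' nonneg] by simp
    then have "AE t in lborel. t \<notin> {p<..<q}"
    proof eventually_elim
      case (elim t)
      then show ?case using pos[of t] by auto
    qed
    then have "emeasure lborel {p<..<q} = 0"
      by (subst (asm) AE_iff_measurable[of "{p<..<q}"]) auto
    with \<open>p < q\<close> show False by simp
  qed
  moreover have "0 \<le> (LINT t|lborel. ?f t)" using nonneg by (rule integral_nonneg_AE)
  ultimately show ?thesis by (simp add: set_lebesgue_integral_def)
qed

subsection \<open>The partial derivative of the cost up to the closure\<close>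

locale split_transport =
  fixes X :: "(real^2) set" and a b :: real and c :: "(real^2) \<times> real \<Rightarrow> real"
    and \<mu> :: "(real^2) measure" and \<nu> :: "real measure"
  assumes open_X: "open X" and connected_X: "connected X" and X_nonempty: "X \<noteq> {}"
    and bounded_X: "bounded X" and a_less_b: "a < b"
    and C2: "C2_closure (X \<times> {a<..<b}) c"
    and gradient: "\<forall>x\<in>X. \<forall>y\<in>{a<..<b}. \<exists>D. (GDERIV (\<lambda>x'. cost_y a b c x' y) x :> D) \<and> D \<noteq> 0"
    and prob_mu: "borel_prob_on X \<mu>" and ac_mu: "absolutely_continuous lborel \<mu>"
    and prob_nu: "borel_prob_on {a<..<b} \<nu>" and ac_nu: "absolutely_continuous lborel \<nu>"
    and split_MCP: "\<forall>x\<in>closure X. \<forall>y\<in>closure {a<..<b}. splits_mass X a b c \<mu> \<nu> x y \<longrightarrow>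
           (\<exists>xt\<in>P_set X a b c \<inter> level_set X a b c x y. mass_comparison X a b c \<mu> \<nu> xt)"
begin

sublocale mu: prob_space \<mu>
  using prob_mu by (simp add: borel_prob_on_def)

sublocale nu: prob_space \<nu>
  using prob_nu by (simp add: borel_prob_on_def)

lemma sets_mu [measurable_cong, simp]: "sets \<mu> = sets borel"
  using prob_mu by (simp add: borel_prob_on_def)

lemma sets_nu [measurable_cong, simp]: "sets \<nu> = sets borel"
  using prob_nu by (simp add: borel_prob_on_def)

lemma space_mu [simp]: "space \<mu> = UNIV"
  using sets_eq_imp_space_eq[OF sets_mu] by simp

lemma space_nu [simp]: "space \<nu> = UNIV"
  using sets_eq_imp_space_eq[OF sets_nu] by simp

lemma X_borel [measurable]: "X \<in> sets borel"
  using open_X by auto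

lemma AE_mu: "AE x in \<mu>. x \<in> X"
  using prob_mu by (intro mu.AE_prob_1) (simp add: borel_prob_on_def measure_def)

lemma AE_nu: "AE y in \<nu>. y \<in> {a<..<b}"
  using prob_nu by (intro nu.AE_prob_1) (simp add: borel_prob_on_def measure_def)

lemma closure_X_compact: "compact (closure X)"
  using bounded_X by (simp add: compact_closure)

lemma in_closure_X: "x \<in> X \<Longrightarrow> x \<in> closure X"
  using closure_subset by blast

abbreviation g :: "real^2 \<Rightarrow> real \<Rightarrow> real" where
  "g \<equiv> cost_y a b c"

lemma closure_product: "closure (X \<times> {a<..<b}) = closure X \<times> {a..b}"
  using a_less_b by (simp add: closure_Times)

lemma continuous_on_cost: "continuous_on (closure X \<times> {a..b}) c"
  using C2 by (auto simp: C2_closure_def closure_product)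

text \<open>Inside, \<open>p\<close> is the derivative of \<open>c\<close> in direction
  \<open>(0, 1)\<close>. The mean value theorem and the uniform continuity of \<open>p\<close> on
  the compact closure bound the linearization error with a \<open>d\<close> independent of the
  points, so that boundary points inherit the bound as limits.\<close>

lemma partial_derivative_extends:
  obtains p where "continuous_on (closure X \<times> {a..b}) p"
    and "\<And>x t. x \<in> closure X \<Longrightarrow> t \<in> {a..b} \<Longrightarrow>
          ((\<lambda>t. c (x, t)) has_real_derivative p (x, t)) (at t within {a..b})"
proof -
  obtain f' :: "(real^2) \<times> real \<Rightarrow> ((real^2) \<times> real) \<Rightarrow>\<^sub>L real"
    where f': "\<And>z. z \<in> X \<times> {a<..<b} \<Longrightarrow> (c has_derivative blinfun_apply (f' z)) (at z)"
      and cont_f': "continuous_on (closure X \<times> {a..b}) f'"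
    using C2 unfolding C2_closure_def closure_product by blast
  define p where "p = (\<lambda>z. f' z (0, 1))"
  have p: "continuous_on (closure X \<times> {a..b}) p"
    unfolding p_def by (intro continuous_intros cont_f')
  have uc: "uniformly_continuous_on (closure X \<times> {a..b}) p"
    by (intro compact_uniformly_continuous p compact_Times closure_X_compact compact_Icc)
  have inner: "((\<lambda>t. c (x, t)) has_real_derivative p (x, t)) (at t)"
    if "x \<in> X" "t \<in> {a<..<b}" for x t
  proof -
    have "(c has_derivative blinfun_apply (f' (x, t))) (at (x, t))"
      using f' that by blast
    moreover have "((\<lambda>t. (x, t)) has_derivative (\<lambda>h. (0, h))) (at t)"
      by (auto intro!: derivative_eq_intros)
    ultimately have "((\<lambda>t. c (x, t)) has_derivative (\<lambda>h. f' (x, t) (0, h))) (at t)"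
      by (rule has_derivative_compose[rotated])
    moreover have "(\<lambda>h. f' (x, t) (0, h)) = (*) (p (x, t))"
    proof
      fix h
      have "f' (x, t) (0, h) = f' (x, t) (h *\<^sub>R (0, 1))" by simp
      then show "f' (x, t) (0, h) = p (x, t) * h"
        unfolding blinfun.scaleR_right p_def by simp
    qed
    ultimately show ?thesis by (simp add: has_field_derivative_def)
  qed
  have bound: "\<bar>c (x, t) - c (x, s) - (t - s) * p (x, s)\<bar> \<le> e * \<bar>t - s\<bar>"
    if d: "\<And>z z'. z \<in> closure X \<times> {a..b} \<Longrightarrow> z' \<in> closure X \<times> {a..b} \<Longrightarrow>
        dist z' z < d \<Longrightarrow> dist (p z') (p z) < e"
      and x: "x \<in> closure X" and s: "s \<in> {a..b}" and t: "t \<in> {a..b}" and st: "\<bar>t - s\<bar> < d"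
    for e d x s t
  proof -
    have int: "\<bar>c (x, t) - c (x, s) - (t - s) * p (x, s)\<bar> \<le> e * \<bar>t - s\<bar>"
      if x: "x \<in> X" and s: "s \<in> {a<..<b}" and t: "t \<in> {a<..<b}" and st: "\<bar>t - s\<bar> < d" for x s t
    proof (cases "s = t")
      case False
      then have "\<exists>z. min s t < z \<and> z < max s t \<and>
          c (x, max s t) - c (x, min s t) = (max s t - min s t) * p (x, z)"
        using s t x by (intro MVT2 inner) (auto simp: min_def max_def split: if_splits)
      then obtain z where z: "min s t < z" "z < max s t"
        "c (x, max s t) - c (x, min s t) = (max s t - min s t) * p (x, z)" by blast
      then have eq: "c (x, t) - c (x, s) = (t - s) * p (x, z)"
        by (cases "s \<le> t") (auto simp: algebra_simps)
      have "z \<in> {a..b}" using z s t by auto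
      moreover have "dist (x, z) (x, s) < d"
        using z st by (auto simp: dist_Pair_Pair dist_real_def)
      ultimately have "dist (p (x, z)) (p (x, s)) < e"
        using x s in_closure_X by (intro d) auto
      then have "\<bar>t - s\<bar> * \<bar>p (x, z) - p (x, s)\<bar> \<le> \<bar>t - s\<bar> * e"
        by (intro mult_left_mono) (auto simp: dist_real_def)
      then show ?thesis
        unfolding eq by (simp add: abs_mult[symmetric] algebra_simps)
    qed auto
    \<comment> \<open>The interior estimate compares continuous expressions, so it passes to the
      limit along interior approximations of \<open>x\<close>, \<open>s\<close> and
      \<open>t\<close>.\<close>
    obtain X' where X': "\<And>n. X' n \<in> X" "X' \<longlonglongrightarrow> x"
      using x closure_sequential by blast
    have "s \<in> closure {a<..<b}" "t \<in> closure {a<..<b}"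
      using s t a_less_b by auto
    then obtain S T where S: "\<And>n. S n \<in> {a<..<b}" "S \<longlonglongrightarrow> s"
      and T: "\<And>n. T n \<in> {a<..<b}" "T \<longlonglongrightarrow> t"
      unfolding closure_sequential by metis
    have lim: "(\<lambda>n. f (X' n, R n)) \<longlonglongrightarrow> f (x, r)"
      if "continuous_on (closure X \<times> {a..b}) f" "R \<longlonglongrightarrow> r" "\<And>n. R n \<in> {a<..<b}" "r \<in> {a..b}"
      for f :: "(real^2) \<times> real \<Rightarrow> real" and R r
    proof (rule continuous_on_tendsto_compose[OF that(1)])
      show "(\<lambda>n. (X' n, R n)) \<longlonglongrightarrow> (x, r)" by (intro tendsto_intros X' that)
      show "\<forall>\<^sub>F n in sequentially. (X' n, R n) \<in> closure X \<times> {a..b}"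
        using X'(1) in_closure_X that(3) by (auto intro!: always_eventually simp: less_imp_le)
    qed (use x that in auto)
    have "(\<lambda>n. \<bar>T n - S n\<bar>) \<longlonglongrightarrow> \<bar>t - s\<bar>" by (intro tendsto_intros S T)
    then have ev: "\<forall>\<^sub>F n in sequentially. \<bar>T n - S n\<bar> < d" using st by (rule order_tendstoD)
    show ?thesis
    proof (rule tendsto_le[OF sequentially_bot])
      show "(\<lambda>n. \<bar>c (X' n, T n) - c (X' n, S n) - (T n - S n) * p (X' n, S n)\<bar>)
          \<longlonglongrightarrow> \<bar>c (x, t) - c (x, s) - (t - s) * p (x, s)\<bar>"
        by (intro tendsto_intros lim continuous_on_cost p S T s t)
      show "(\<lambda>n. e * \<bar>T n - S n\<bar>) \<longlonglongrightarrow> e * \<bar>t - s\<bar>" by (intro tendsto_intros S T)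
      show "\<forall>\<^sub>F n in sequentially. \<bar>c (X' n, T n) - c (X' n, S n) - (T n - S n) * p (X' n, S n)\<bar>
          \<le> e * \<bar>T n - S n\<bar>"
        using ev by eventually_elim (intro int X' S T)
    qed
  qed
  have "((\<lambda>t. c (x, t)) has_real_derivative p (x, s)) (at s within {a..b})"
    if x: "x \<in> closure X" and s: "s \<in> {a..b}" for x s
    unfolding has_field_derivative_def has_derivative_within_alt
  proof (intro conjI allI impI)
    show "bounded_linear ((*) (p (x, s)))" by (rule bounded_linear_mult_right)
    fix e :: real assume "e > 0"
    then obtain d where d: "d > 0" "\<And>z z'. z \<in> closure X \<times> {a..b} \<Longrightarrow> z' \<in> closure X \<times> {a..b} \<Longrightarrow>
        dist z' z < d \<Longrightarrow> dist (p z') (p z) < e"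
      using uc unfolding uniformly_continuous_on_def by metis
    show "\<exists>d>0. \<forall>y\<in>{a..b}. norm (y - s) < d \<longrightarrow>
        norm (c (x, y) - c (x, s) - p (x, s) * (y - s)) \<le> e * norm (y - s)"
      using bound[OF d(2) x s] d(1) by (auto simp: mult.commute)
  qed
  with p show ?thesis by (rule that)
qed

lemma has_derivative_cost:
  assumes "x \<in> closure X" "t \<in> {a..b}"
  shows "((\<lambda>t. c (x, t)) has_real_derivative g x t) (at t within {a..b})"
proof -
  obtain p where "((\<lambda>t. c (x, t)) has_real_derivative p (x, t)) (at t within {a..b})"
    using partial_derivative_extends assms by metis
  then show ?thesis
    unfolding cost_y_def has_real_derivative_iff_has_vector_derivative
    using vector_derivative_works differentiableI_vector by blast
qed

text \<open>Derivatives within a nondegenerate interval are unique, also at its endpoints, so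
  \<open>g\<close> coincides with the continuous extension \<open>p\<close>.\<close>

lemma continuous_on_cost_y: "continuous_on (closure X \<times> {a..b}) (\<lambda>z. g (fst z) (snd z))"
proof -
  obtain p where p: "continuous_on (closure X \<times> {a..b}) p"
    and der: "\<And>x t. x \<in> closure X \<Longrightarrow> t \<in> {a..b} \<Longrightarrow>
          ((\<lambda>t. c (x, t)) has_real_derivative p (x, t)) (at t within {a..b})"
    using partial_derivative_extends by metis
  have "p z = g (fst z) (snd z)" if "z \<in> closure X \<times> {a..b}" for z
    using der[of "fst z" "snd z"] that a_less_b
      vector_derivative_within_cbox[of a b "snd z" "\<lambda>t. c (fst z, t)" "p z"]
    unfolding cost_y_def by (auto simp: has_real_derivative_iff_has_vector_derivative)
  with p show ?thesis by (simp cong: continuous_on_cong)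
qed

lemma cost_y_tendsto:
  assumes "(\<xi> \<longlongrightarrow> x) \<F>" "(\<eta> \<longlongrightarrow> y) \<F>"
    and "\<forall>\<^sub>F n in \<F>. \<xi> n \<in> closure X" "\<forall>\<^sub>F n in \<F>. \<eta> n \<in> {a..b}"
    and "x \<in> closure X" "y \<in> {a..b}"
  shows "((\<lambda>n. g (\<xi> n) (\<eta> n)) \<longlongrightarrow> g x y) \<F>"
  using continuous_on_tendsto_compose[OF continuous_on_cost_y tendsto_Pair[OF assms(1,2)]]
    assms(5,6) eventually_conj[OF assms(3,4)]
  by simp

lemma continuous_on_cost_y_fst: "y \<in> {a..b} \<Longrightarrow> continuous_on (closure X) (\<lambda>x. g x y)"
  by (rule continuous_on_compose2[OF continuous_on_cost_y, of _ "\<lambda>x. (x, y)", simplified])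
     (auto intro!: continuous_intros)

lemma continuous_on_cost_y_snd: "x \<in> closure X \<Longrightarrow> continuous_on {a..b} (g x)"
  by (rule continuous_on_compose2[OF continuous_on_cost_y, of _ "\<lambda>y. (x, y)", simplified])
     (auto intro!: continuous_intros)

lemma cost_y_preimage_borel:
  assumes y: "y \<in> {a..b}" and T: "T \<in> sets borel"
  shows "{x \<in> X. g x y \<in> T} \<in> sets borel"
proof -
  have "(\<lambda>x. g x y) \<in> borel_measurable (restrict_space borel X)"
    using continuous_on_subset[OF continuous_on_cost_y_fst[OF y] closure_subset]
    by (rule borel_measurable_continuous_on_restrict)
  from measurable_sets[OF this T] show ?thesis
    by (simp add: sets_restrict_space_iff space_restrict_space vimage_def Int_def conj_commute)
qed

lemma level_set_null:
  assumes y: "y \<in> {a<..<b}"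
  shows "{x \<in> X. g x y = k} \<in> null_sets \<mu>"
proof -
  have "{x \<in> X. g x y = k} \<in> null_sets lebesgue"
    using negligible_level_set_gradient[of X "\<lambda>x. g x y" k] gradient y
    by (simp add: negligible_iff_null_sets)
  moreover have "{x \<in> X. g x y = k} \<in> sets borel"
    using cost_y_preimage_borel[of y "{k}"] y by simp
  ultimately have "{x \<in> X. g x y = k} \<in> null_sets lborel"
    by (simp add: null_sets_def)
  then show ?thesis
    using ac_mu by (auto simp: absolutely_continuous_def)
qed

lemma nu_singleton: "measure \<nu> {y} = 0"
proof -
  have "{y} \<in> null_sets lborel" by (simp add: null_sets_def)
  then have "{y} \<in> null_sets \<nu>" using ac_nu by (auto simp: absolutely_continuous_def)
  then show ?thesis by (auto simp: null_sets_def measure_def)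
qed

subsection \<open>Single crossing\<close>

lemma AE_nu_neq: "AE t in \<nu>. t \<noteq> y"
  using nu_singleton[of y] by (subst AE_iff_measurable[of "{y}"]) (auto simp: nu.emeasure_eq_measure)

section \<open>Continuity of the mass excess\<close>

definition superlevel :: "real^2 \<Rightarrow> real \<Rightarrow> (real^2) set" where
  "superlevel x y = {x' \<in> X. g x y < g x' y}"

definition excess :: "real^2 \<Rightarrow> real \<Rightarrow> real" where
  "excess x y = measure \<mu> (superlevel x y) - measure \<nu> {a..<y}"

lemma splits_mass_iff: "splits_mass X a b c \<mu> \<nu> x y \<longleftrightarrow> excess x y = 0"
  by (simp add: splits_mass_def excess_def superlevel_def)

lemma superlevel_borel [measurable]: "y \<in> {a..b} \<Longrightarrow> superlevel x y \<in> sets borel"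
  using cost_y_preimage_borel[of y "{g x y<..}"] by (simp add: superlevel_def)

lemma excess_mono:
  assumes "y \<in> {a..b}" "g x y \<le> g x' y"
  shows "excess x' y \<le> excess x y"
  unfolding excess_def
  using assms by (auto intro!: mu.finite_measure_mono) (auto simp: superlevel_def)

text \<open>Turns mass information into strict level information. The converse fails in general,
  since \<mu> may vanish between two levels.\<close>

lemma excess_less_imp: "y \<in> {a..b} \<Longrightarrow> excess x y < excess x' y \<Longrightarrow> g x' y < g x y"
  using excess_mono[of y x x'] by linarith

lemma nu_tendsto:
  assumes "\<eta> \<longlonglongrightarrow> y"
  shows "(\<lambda>n. measure \<nu> {a..<\<eta> n}) \<longlonglongrightarrow> measure \<nu> {a..<y}"
proof -
  have "(\<lambda>n. LINT t|\<nu>. indicator {a..<\<eta> n} t) \<longlonglongrightarrow> (LINT t|\<nu>. (indicator {a..<y} t :: real))"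
  proof (rule integral_dominated_convergence[where w = "\<lambda>_. 1"])
    show "AE t in \<nu>. (\<lambda>n. indicator {a..<\<eta> n} t) \<longlonglongrightarrow> (indicator {a..<y} t :: real)"
      using AE_nu_neq[of y]
    proof eventually_elim
      fix t assume "t \<noteq> y"
      then consider "t < y" | "y < t" by linarith
      then have "\<forall>\<^sub>F n in sequentially. (indicator {a..<\<eta> n} t :: real) = indicator {a..<y} t"
      proof cases
        case 1
        with order_tendstoD(1)[OF assms 1] show ?thesis
          by (auto elim!: eventually_mono simp: indicator_def)
      next
        case 2
        with order_tendstoD(2)[OF assms 2] show ?thesis
          by (auto elim!: eventually_mono simp: indicator_def)
      qed
      then show "(\<lambda>n. indicator {a..<\<eta> n} t) \<longlonglongrightarrow> (indicator {a..<y} t :: real)"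
        by (rule tendsto_eventually)
    qed
  qed auto
  then show ?thesis by simp
qed

text \<open>The indicators converge wherever \<open>g z y\<close> differs from \<open>g x y\<close>.
  The exceptional level set is \<mu>-null because \<open>y\<close> lies in the open interval, where
  the gradient of \<open>g\<close> does not vanish; at \<open>a\<close> or \<open>b\<close> a level
  set may carry mass.\<close>

lemma superlevel_tendsto:
  assumes \<xi>: "\<xi> \<longlonglongrightarrow> x" "\<And>n. \<xi> n \<in> closure X" "x \<in> closure X"
    and \<eta>: "\<eta> \<longlonglongrightarrow> y" "\<And>n. \<eta> n \<in> {a..b}" "y \<in> {a<..<b}"
  shows "(\<lambda>n. measure \<mu> (superlevel (\<xi> n) (\<eta> n))) \<longlonglongrightarrow> measure \<mu> (superlevel x y)"
proof -
  have y: "y \<in> {a..b}" using \<eta>(3) by auto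
  have "(\<lambda>n. LINT z|\<mu>. indicator (superlevel (\<xi> n) (\<eta> n)) z)
      \<longlonglongrightarrow> (LINT z|\<mu>. (indicator (superlevel x y) z :: real))"
  proof (rule integral_dominated_convergence[where w = "\<lambda>_. 1"])
    have "AE z in \<mu>. z \<notin> {z \<in> X. g z y = g x y}"
      using level_set_null[OF \<eta>(3)] by (rule AE_not_in)
    then show "AE z in \<mu>. (\<lambda>n. indicator (superlevel (\<xi> n) (\<eta> n)) z)
        \<longlonglongrightarrow> (indicator (superlevel x y) z :: real)"
      using AE_mu
    proof eventually_elim
      fix z assume z: "z \<notin> {z \<in> X. g z y = g x y}" "z \<in> X"
      have "(\<lambda>n. g (\<xi> n) (\<eta> n) - g z (\<eta> n)) \<longlonglongrightarrow> g x y - g z y"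
        using \<xi> \<eta> z in_closure_X by (intro tendsto_diff cost_y_tendsto) auto
      note lim = order_tendstoD[OF this]
      from z consider "g x y - g z y < 0" | "0 < g x y - g z y" by fastforce
      then have "\<forall>\<^sub>F n in sequentially.
          (indicator (superlevel (\<xi> n) (\<eta> n)) z :: real) = indicator (superlevel x y) z"
      proof cases
        case 1
        with lim(2)[OF 1] z show ?thesis
          by (auto elim!: eventually_mono simp: indicator_def superlevel_def)
      next
        case 2
        with lim(1)[OF 2] z show ?thesis
          by (auto elim!: eventually_mono simp: indicator_def superlevel_def)
      qed
      then show "(\<lambda>n. indicator (superlevel (\<xi> n) (\<eta> n)) z)
          \<longlonglongrightarrow> (indicator (superlevel x y) z :: real)"
        by (rule tendsto_eventually)
    qed
  qed (use \<eta>(2) y in auto)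
  then show ?thesis by simp
qed

lemma excess_tendsto:
  assumes "\<xi> \<longlonglongrightarrow> x" "\<And>n. \<xi> n \<in> closure X" "x \<in> closure X"
    and "\<eta> \<longlonglongrightarrow> y" "\<And>n. \<eta> n \<in> {a..b}" "y \<in> {a<..<b}"
  shows "(\<lambda>n. excess (\<xi> n) (\<eta> n)) \<longlonglongrightarrow> excess x y"
  unfolding excess_def by (intro tendsto_diff superlevel_tendsto nu_tendsto assms)

lemma continuous_on_excess_fst:
  assumes "y \<in> {a<..<b}"
  shows "continuous_on (closure X) (\<lambda>x. excess x y)"
  unfolding continuous_on_sequentially comp_def
proof (intro allI ballI impI, elim conjE)
  fix \<xi> x assume "x \<in> closure X" "\<forall>n. \<xi> n \<in> closure X" "\<xi> \<longlonglongrightarrow> x"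
  then show "(\<lambda>n. excess (\<xi> n) y) \<longlonglongrightarrow> excess x y"
    using assms by (intro excess_tendsto) auto
qed

lemma continuous_on_excess_snd:
  assumes "x \<in> closure X"
  shows "continuous_on {a<..<b} (excess x)"
  unfolding continuous_on_sequentially comp_def
proof (intro allI ballI impI, elim conjE)
  fix \<eta> y assume "y \<in> {a<..<b}" "\<forall>n. \<eta> n \<in> {a<..<b}" "\<eta> \<longlonglongrightarrow> y"
  then show "(\<lambda>n. excess x (\<eta> n)) \<longlonglongrightarrow> excess x y"
    using assms by (intro excess_tendsto) (auto simp: less_imp_le)
qed

section \<open>Splitting points and pivots\<close>

text \<open>At a maximizer of \<open>g\<close> over \<open>closure X\<close> the superlevel set is
  empty; at a minimizer it has full mass, as the level set is null. Connectedness of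
  \<open>closure X\<close> gives a zero of the excess in between.\<close>

lemma split_point_exists:
  assumes y: "y \<in> {a<..<b}"
  shows "\<exists>x\<in>closure X. excess x y = 0"
proof -
  have y': "y \<in> {a..b}" using y by auto
  have ne: "closure X \<noteq> {}" using X_nonempty by simp
  obtain xM where xM: "xM \<in> closure X" "\<And>x. x \<in> closure X \<Longrightarrow> g x y \<le> g xM y"
    using continuous_attains_sup[OF closure_X_compact ne continuous_on_cost_y_fst[OF y']] by blast
  obtain xm where xm: "xm \<in> closure X" "\<And>x. x \<in> closure X \<Longrightarrow> g xm y \<le> g x y"
    using continuous_attains_inf[OF closure_X_compact ne continuous_on_cost_y_fst[OF y']] by blast
  have "superlevel xM y = {}"
    using xM(2) in_closure_X by (force simp: superlevel_def)
  then have M: "excess xM y \<le> 0" by (simp add: excess_def)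
  have "AE z in \<mu>. z \<in> superlevel xm y"
    using AE_mu AE_not_in[OF level_set_null[OF y, of "g xm y"]]
  proof eventually_elim
    case (elim z)
    then show ?case using xm(2)[of z] in_closure_X by (auto simp: superlevel_def)
  qed
  then have "measure \<mu> (superlevel xm y) = 1"
    using superlevel_borel[OF y'] by (subst (asm) mu.AE_in_set_eq_1) auto
  then have m: "0 \<le> excess xm y"
    using nu.prob_le_1[of "{a..<y}"] by (simp add: excess_def)
  have "connected (closure X)" using connected_X by (rule connected_imp_connected_closure)
  then have "connected ((\<lambda>x. excess x y) ` closure X)"
    using continuous_on_excess_fst[OF y] connected_continuous_image by blast
  then have "0 \<in> (\<lambda>x. excess x y) ` closure X"
    using M m xM(1) xm(1) by (auto intro: connectedD_interval)
  then obtain x where "0 = excess x y" "x \<in> closure X" by (rule imageE)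
  then show ?thesis by (intro bexI[of _ x]) simp_all
qed

text \<open>The point supplied by \<open>split_MCP\<close> shares its level at \<open>y\<close> with
  a splitting point, hence also its excess. It lies in \<open>X\<close> itself because level sets
  do.\<close>

lemma pivot_exists:
  assumes y: "y \<in> {a<..<b}"
  obtains z where "z \<in> X" "z \<in> P_set X a b c" "mass_comparison X a b c \<mu> \<nu> z" "excess z y = 0"
proof -
  obtain x where x: "x \<in> closure X" "excess x y = 0" using split_point_exists[OF y] by blast
  moreover have "y \<in> closure {a<..<b}" using y closure_subset by blast
  ultimately obtain z where z: "z \<in> P_set X a b c" "z \<in> level_set X a b c x y"
    "mass_comparison X a b c \<mu> \<nu> z"
    using split_MCP unfolding splits_mass_iff by blast
  then have "z \<in> X" "g z y = g x y" by (auto simp: level_set_def)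
  moreover from this x have "excess z y = 0" by (simp add: excess_def superlevel_def)
  ultimately show ?thesis using z that by blast
qed

text \<open>Intermediate value theorem for the difference of two level curves. It serves both the
  mass estimate behind the MCP and the contradiction with \<open>P_set\<close>.\<close>

lemma crossing:
  assumes "z \<in> closure X" "x \<in> closure X" "y \<in> {a..b}" "y' \<in> {a..b}" "y \<le> y'"
    and "(g x y \<le> g z y \<and> g z y' \<le> g x y') \<or> (g z y \<le> g x y \<and> g x y' \<le> g z y')"
  obtains t where "t \<in> {y..y'}" "g x t = g z t"
proof -
  have cont: "continuous_on {y..y'} (\<lambda>t. g x t - g z t)"
    using assms(1-5) by (intro continuous_on_diff) (auto intro: continuous_on_subset[OF continuous_on_cost_y_snd])
  have "\<exists>t. y \<le> t \<and> t \<le> y' \<and> g x t - g z t = 0"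
    using assms(6) IVT'[OF _ _ assms(5) cont, of 0] IVT2'[OF _ _ assms(5) cont, of 0] by auto
  with that show ?thesis by auto
qed

text \<open>A point of \<open>superlevel z y'\<close> outside \<open>superlevel z y\<close> crosses
  the level of \<open>z\<close> in between, so it lies in \<open>?U\<close>, whose mass the MCP
  bounds strictly by that of \<open>{y..y'}\<close>.\<close>

lemma excess_strict_decreasing:
  assumes z: "z \<in> X" and mcp: "mass_comparison X a b c \<mu> \<nu> z"
    and y: "y \<in> {a<..<b}" "y' \<in> {a<..<b}" "y < y'"
  shows "excess z y' < excess z y"
proof -
  let ?U = "\<Union>t\<in>{y..y'}. level_set X a b c z t"
  have "?U \<in> sets borel"
  proof -
    \<comment> \<open>\<open>?U\<close> is the trace on \<open>X\<close> of the projection of this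
      compact set; its measurability justifies monotonicity and subadditivity of the measure
      below.\<close>
    let ?K = "{w \<in> closure X \<times> {y..y'}. g (fst w) (snd w) - g z (snd w) = 0}"
    have "continuous_on (closure X \<times> {y..y'}) (\<lambda>w. g (fst w) (snd w) - g z (snd w))"
    proof (rule continuous_on_diff)
      show "continuous_on (closure X \<times> {y..y'}) (\<lambda>w. g (fst w) (snd w))"
        using y by (auto intro: continuous_on_subset[OF continuous_on_cost_y])
      show "continuous_on (closure X \<times> {y..y'}) (\<lambda>w. g z (snd w))"
        using y z in_closure_X
        by (intro continuous_on_compose2[OF continuous_on_cost_y_snd[of z]]) (auto intro!: continuous_intros)
    qed
    then have "closed ?K"
      by (rule continuous_closed_preimage_constant) (auto intro: closed_Times)
    moreover have "compact (closure X \<times> {y..y'})"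
      by (intro compact_Times closure_X_compact compact_Icc)
    ultimately have "compact ((closure X \<times> {y..y'}) \<inter> ?K)"
      by (rule compact_Int_closed[rotated])
    then have "compact ?K" by (simp add: Int_def Collect_conj_eq[symmetric] conj_ac cong: conj_cong)
    then have "compact (fst ` ?K)" by (intro compact_continuous_image continuous_intros)
    then have "fst ` ?K \<in> sets borel" by (intro borel_closed compact_imp_closed)
    moreover have "?U = fst ` ?K \<inter> X"
      using in_closure_X by (force simp: level_set_def image_iff)
    ultimately show ?thesis by simp
  qed
  then have U: "?U \<in> sets \<mu>" by simp
  have "superlevel z y' \<subseteq> superlevel z y \<union> ?U"
  proof
    fix x assume x: "x \<in> superlevel z y'"
    show "x \<in> superlevel z y \<union> ?U"
    proof (cases "g z y < g x y")
      case False
      then obtain t where "t \<in> {y..y'}" "g x t = g z t"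
        using crossing[of z x y y'] x y z in_closure_X by (auto simp: superlevel_def)
      with x show ?thesis by (auto simp: superlevel_def level_set_def)
    qed (use x in \<open>auto simp: superlevel_def\<close>)
  qed
  then have "measure \<mu> (superlevel z y') \<le> measure \<mu> (superlevel z y \<union> ?U)"
    using y U by (intro mu.finite_measure_mono) auto
  also have "\<dots> \<le> measure \<mu> (superlevel z y) + measure \<mu> ?U"
    using y U by (intro measure_Un_le) auto
  also have "\<dots> < measure \<mu> (superlevel z y) + measure \<nu> {y..y'}"
    using mcp y unfolding mass_comparison_def by simp
  also have "measure \<nu> {y..y'} = measure \<nu> {y..<y'} + measure \<nu> {y'}"
    using y by (subst nu.finite_measure_Union[symmetric]) (auto intro: arg_cong[where f = "measure \<nu>"])
  also have "measure \<nu> {y..<y'} = measure \<nu> {a..<y'} - measure \<nu> {a..<y}"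
    using y by (subst nu.finite_measure_Diff[symmetric]) (auto intro: arg_cong[where f = "measure \<nu>"])
  finally show ?thesis by (simp add: excess_def nu_singleton)
qed

lemma excess_single_crossing:
  assumes x: "x \<in> closure X" and y: "y \<in> {a<..<b}" "y' \<in> {a<..<b}" "y < y'"
    and le: "excess x y \<le> 0"
  shows "excess x y' < 0"
proof (rule ccontr)
  assume ge: "\<not> excess x y' < 0"
  obtain m where m: "y < m" "m < y'" using y dense by blast
  then have mI: "m \<in> {a<..<b}" using y by auto
  obtain z where z: "z \<in> X" "z \<in> P_set X a b c" "mass_comparison X a b c \<mu> \<nu> z" "excess z m = 0"
    using pivot_exists[OF mI] .
  have "excess x y < excess z y" "excess z y' < excess x y'"
    using excess_strict_decreasing[OF z(1,3) y(1) mI m(1)]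
      excess_strict_decreasing[OF z(1,3) mI y(2) m(2)] z(4) le ge by auto
  then have cross: "g z y < g x y" "g x y' < g z y'"
    using y by (auto intro: excess_less_imp)
  \<comment> \<open>Level sets contain only points of \<open>X\<close>, so a boundary point
    \<open>x\<close> has to be replaced by a nearby point of \<open>X\<close> before
    \<open>P_set\<close> applies.\<close>
  obtain \<xi> where \<xi>: "\<And>n. \<xi> n \<in> X" "\<xi> \<longlonglongrightarrow> x" using x closure_sequential by blast
  have lim: "(\<lambda>n. g (\<xi> n) t) \<longlonglongrightarrow> g x t" if "t \<in> {a<..<b}" for t
    using \<xi> in_closure_X x that by (intro cost_y_tendsto) auto
  have "\<forall>\<^sub>F n in sequentially. g z y < g (\<xi> n) y \<and> g (\<xi> n) y' < g z y'"
    using order_tendstoD(1)[OF lim[OF y(1)] cross(1)] order_tendstoD(2)[OF lim[OF y(2)] cross(2)]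
    by (rule eventually_conj)
  then obtain x' where x': "x' \<in> X" "g z y < g x' y" "g x' y' < g z y'"
    using \<xi>(1) by (auto dest!: eventually_happens'[OF sequentially_bot])
  obtain t where t: "t \<in> {y..y'}" "g x' t = g z t"
    using crossing[of z x' y y'] x' z(1) y in_closure_X by auto
  \<comment> \<open>The definition of \<open>P_set\<close> is applied at \<open>t\<close> and
    \<open>y'\<close>, which requires \<open>t < y'\<close>; strictness at \<open>y'\<close>
    provides it.\<close>
  with x' have "t \<noteq> y'" by auto
  with t(1) y have tI: "t \<in> {a<..<b}" and "t < y'" by auto
  moreover have "x' \<in> level_set X a b c z t"
    using x'(1) t(2) by (simp add: level_set_def)
  ultimately have "g z y' \<le> g x' y'"
    using z(2) y(2) unfolding P_set_def by blast
  with x' show False by simp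
qed

subsection \<open>The map and its continuity\<close>

text \<open>Inserting \<open>a\<close> keeps the supremum over a nonempty set and yields
  \<open>a\<close> where the excess is never positive. The value \<open>a\<close> off
  \<open>closure X\<close> makes \<open>F\<close> Borel with values in \<open>{a..b}\<close>
  everywhere.\<close>

definition F :: "real^2 \<Rightarrow> real" where
  "F x = (if x \<in> closure X then Sup (insert a {y \<in> {a<..<b}. 0 < excess x y}) else a)"

lemma bdd_above_excess: "bdd_above (insert a {y \<in> {a<..<b}. 0 < excess x y})"
  using a_less_b by (auto intro!: bdd_aboveI[of _ b])

lemma F_bounds: "F x \<in> {a..b}"
proof -
  have "a \<le> Sup (insert a {y \<in> {a<..<b}. 0 < excess x y})"
    using bdd_above_excess by (intro cSup_upper) auto
  moreover have "Sup (insert a {y \<in> {a<..<b}. 0 < excess x y}) \<le> b"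
    using a_less_b by (intro cSup_least) auto
  ultimately show ?thesis using a_less_b by (simp add: F_def)
qed

text \<open>Continuity in \<open>y\<close> keeps a strict sign slightly beyond \<open>y\<close>,
  which yields the strict inequalities between \<open>y\<close> and \<open>F x\<close>.\<close>

lemma excess_near:
  assumes x: "x \<in> closure X" and y: "y \<in> {a<..<b}"
  shows "0 < excess x y \<Longrightarrow> \<exists>y'\<in>{y<..<b}. 0 < excess x y'"
    and "excess x y < 0 \<Longrightarrow> \<exists>y'\<in>{a<..<y}. excess x y' < 0"
proof -
  have "isCont (excess x) y"
    using continuous_on_excess_snd[OF x] y by (auto simp: continuous_on_eq_continuous_at)
  then have lim: "(excess x \<longlongrightarrow> excess x y) (at y)" by (simp add: isCont_def)
  then have right: "(excess x \<longlongrightarrow> excess x y) (at_right y)"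
    and left: "(excess x \<longlongrightarrow> excess x y) (at_left y)"
    by (auto intro: tendsto_within_subset)
  show "\<exists>y'\<in>{y<..<b}. 0 < excess x y'" if "0 < excess x y"
    using eventually_happens[OF eventually_conj[OF order_tendstoD(1)[OF right that] eventually_at_right_real[of y b]]] y
    by auto
  show "\<exists>y'\<in>{a<..<y}. excess x y' < 0" if "excess x y < 0"
    using eventually_happens[OF eventually_conj[OF order_tendstoD(2)[OF left that] eventually_at_left_real[of a y]]] y
    by auto
qed

lemma less_F_iff:
  assumes x: "x \<in> closure X" and y: "y \<in> {a<..<b}"
  shows "y < F x \<longleftrightarrow> 0 < excess x y"
proof
  assume "y < F x"
  then have "\<exists>y'\<in>insert a {y \<in> {a<..<b}. 0 < excess x y}. y < y'"
    using x by (simp only: F_def if_True less_cSup_iff[OF insert_not_empty bdd_above_excess])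
  then obtain y' where "y' \<in> {a<..<b}" "0 < excess x y'" "y < y'"
    using y by auto
  then show "0 < excess x y"
    using excess_single_crossing[OF x y, of y'] by force
next
  assume "0 < excess x y"
  then obtain y' where "y' \<in> {y<..<b}" "0 < excess x y'" using excess_near(1)[OF x y] by blast
  with y have "y' \<in> insert a {y \<in> {a<..<b}. 0 < excess x y}" "y < y'" by auto
  then have "\<exists>y'\<in>insert a {y \<in> {a<..<b}. 0 < excess x y}. y < y'" by blast
  with x show "y < F x"
    by (simp only: F_def if_True less_cSup_iff[OF insert_not_empty bdd_above_excess])
qed

lemma F_less_iff:
  assumes x: "x \<in> closure X" and y: "y \<in> {a<..<b}"
  shows "F x < y \<longleftrightarrow> excess x y < 0"
proof
  assume "F x < y"
  \<comment> \<open>At \<open>y'\<close> the excess is only known to be nonpositive; single crossing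
    makes it negative at the larger \<open>y\<close>.\<close>
  then obtain y' where y': "F x < y'" "y' < y" using dense by blast
  then have I: "y' \<in> {a<..<b}" using F_bounds[of x] y by auto
  with y' less_F_iff[OF x I] have "excess x y' \<le> 0" by auto
  with y' show "excess x y < 0" by (intro excess_single_crossing[OF x I y]) auto
next
  assume "excess x y < 0"
  then obtain y' where y': "y' \<in> {a<..<y}" "excess x y' < 0" using excess_near(2)[OF x y] by blast
  with y have "y' \<in> {a<..<b}" by auto
  with y' less_F_iff[OF x this] show "F x < y" by auto
qed

lemma F_eq_iff:
  assumes "x \<in> closure X" "y \<in> {a<..<b}"
  shows "F x = y \<longleftrightarrow> excess x y = 0"
  unfolding order_eq_iff not_less[symmetric] less_F_iff[OF assms] F_less_iff[OF assms]
  by blast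

lemma continuous_on_F: "continuous_on (closure X) F"
  unfolding continuous_on_sequentially comp_def
proof (intro allI ballI impI, elim conjE)
  fix \<xi> x assume x: "x \<in> closure X" and \<xi>: "\<forall>n. \<xi> n \<in> closure X" "\<xi> \<longlonglongrightarrow> x"
  have lim: "(\<lambda>n. excess (\<xi> n) y) \<longlonglongrightarrow> excess x y" if "y \<in> {a<..<b}" for y
    using \<xi> x that by (intro excess_tendsto) auto
  show "(\<lambda>n. F (\<xi> n)) \<longlonglongrightarrow> F x"
  proof (rule order_tendstoI)
    fix l assume l: "l < F x"
    show "\<forall>\<^sub>F n in sequentially. l < F (\<xi> n)"
    proof (cases "l < a")
      case True
      then have "l < F z" for z using F_bounds[of z] by auto
      then show ?thesis by simp
    next
      case False
      \<comment> \<open>The intermediate \<open>y\<close> lies in the open interval and turns the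
        inequality for \<open>F\<close> into a strict sign of \<open>excess\<close>, which persists
        along the sequence.\<close>
      obtain y where y: "l < y" "y < F x" using l dense by blast
      with False have I: "y \<in> {a<..<b}" using F_bounds[of x] by auto
      have "\<forall>\<^sub>F n in sequentially. 0 < excess (\<xi> n) y"
        using order_tendstoD(1)[OF lim[OF I]] less_F_iff[OF x I] y by auto
      then show ?thesis
        using less_F_iff[OF _ I] \<xi>(1) y(1) by (auto elim!: eventually_mono intro: less_trans)
    qed
  next
    fix u assume u: "F x < u"
    show "\<forall>\<^sub>F n in sequentially. F (\<xi> n) < u"
    proof (cases "b < u")
      case True
      then have "F z < u" for z using F_bounds[of z] by auto
      then show ?thesis by simp
    next
      case False
      obtain y where y: "F x < y" "y < u" using u dense by blast
      with False have I: "y \<in> {a<..<b}" using F_bounds[of x] by auto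
      have "\<forall>\<^sub>F n in sequentially. excess (\<xi> n) y < 0"
        using order_tendstoD(2)[OF lim[OF I]] F_less_iff[OF x I] y by auto
      then show ?thesis
        using F_less_iff[OF _ I] \<xi>(1) y(2) by (auto elim!: eventually_mono intro: less_trans)
    qed
  qed
qed

lemma F_borel [measurable]: "F \<in> borel_measurable borel"
proof -
  have "(\<lambda>x. if x \<in> closure X then F x else a) \<in> borel_measurable borel"
    by (intro borel_measurable_continuous_on_if continuous_on_F continuous_intros) auto
  moreover have "(\<lambda>x. if x \<in> closure X then F x else a) = F" by (auto simp: F_def)
  ultimately show ?thesis by simp
qed

text \<open>Since \<open>{a..<a}\<close> is empty, \<open>superlevel x a\<close> has to be null. The
  level set at \<open>a\<close> may carry mass, so only lower semicontinuity is used: points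
  strictly above the level of \<open>x\<close> at \<open>a\<close> stay above it at nearby
  \<open>\<eta> n\<close>, where the superlevel mass is at most that of
  \<open>{a..<\<eta> n}\<close>, which tends to zero.\<close>

lemma excess_left_endpoint:
  assumes x: "x \<in> closure X" and F: "F x = a"
  shows "excess x a = 0"
proof -
  obtain \<eta> where \<eta>: "\<And>n::nat. \<eta> n \<in> {a<..<b}" and lim\<eta>: "\<eta> \<longlonglongrightarrow> a"
    using right_approaching_sequence[OF a_less_b] by metis
  have le: "measure \<mu> (superlevel x (\<eta> n)) \<le> measure \<nu> {a..<\<eta> n}" for n
    using F_less_iff[OF x \<eta>[of n]] \<eta>[of n] F by (auto simp: excess_def)
  \<comment> \<open>The factor \<open>indicator (superlevel x a)\<close> removes the points on the
    level at \<open>a\<close>, where the other indicator need not converge.\<close>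
  have "(\<lambda>n. LINT z|\<mu>. indicator (superlevel x a) z * indicator (superlevel x (\<eta> n)) z)
      \<longlonglongrightarrow> (LINT z|\<mu>. (indicator (superlevel x a) z :: real))"
  proof (rule integral_dominated_convergence[where w = "\<lambda>_. 1"])
    show "AE z in \<mu>. (\<lambda>n. indicator (superlevel x a) z * indicator (superlevel x (\<eta> n)) z)
        \<longlonglongrightarrow> (indicator (superlevel x a) z :: real)"
    proof (rule AE_I2, rule tendsto_eventually)
      fix z
      show "\<forall>\<^sub>F n in sequentially.
          indicator (superlevel x a) z * indicator (superlevel x (\<eta> n)) z = (indicator (superlevel x a) z :: real)"
      proof (cases "z \<in> superlevel x a")
        case True
        then have z: "z \<in> X" "g x a - g z a < 0" by (auto simp: superlevel_def)
        have "(\<lambda>n. g x (\<eta> n) - g z (\<eta> n)) \<longlonglongrightarrow> g x a - g z a"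
          using z x \<eta> lim\<eta> in_closure_X a_less_b
          by (intro tendsto_diff cost_y_tendsto) (auto simp: less_imp_le)
        from order_tendstoD(2)[OF this z(2)] show ?thesis
          using z(1) by (auto elim!: eventually_mono simp: superlevel_def indicator_def)
      qed auto
    qed
  qed (use \<eta> a_less_b in \<open>auto simp: less_imp_le indicator_def intro!: borel_measurable_times borel_measurable_indicator\<close>)
  moreover have "(LINT z|\<mu>. indicator (superlevel x a) z * indicator (superlevel x (\<eta> n)) z)
      \<le> measure \<nu> {a..<\<eta> n}" for n
  proof -
    have "(LINT z|\<mu>. indicator (superlevel x a) z * indicator (superlevel x (\<eta> n)) z)
        = measure \<mu> (superlevel x a \<inter> superlevel x (\<eta> n))"
      by (simp add: indicator_inter_arith[symmetric])
    also have "\<dots> \<le> measure \<mu> (superlevel x (\<eta> n))"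
      using \<eta>[of n] by (intro mu.finite_measure_mono) auto
    finally show ?thesis using le[of n] by simp
  qed
  ultimately have "(LINT z|\<mu>. (indicator (superlevel x a) z :: real)) \<le> measure \<nu> {a..<a}"
    using nu_tendsto[OF lim\<eta>] by (intro LIMSEQ_le) auto
  then show ?thesis
    using measure_nonneg[of \<mu> "superlevel x a"] by (simp add: excess_def)
qed

lemma F_splits_mass:
  assumes x: "x \<in> closure X" and F: "F x \<noteq> b"
  shows "splits_mass X a b c \<mu> \<nu> x (F x)"
proof (cases "F x = a")
  case True
  with excess_left_endpoint[OF x] show ?thesis by (simp add: splits_mass_iff)
next
  case False
  then have "F x \<in> {a<..<b}" using F F_bounds[of x] by auto
  from F_eq_iff[OF x this] show ?thesis unfolding splits_mass_iff by blast
qed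

lemma split_unique:
  assumes "x \<in> closure X" "y \<in> {a<..<b}" "splits_mass X a b c \<mu> \<nu> x y"
  shows "y = F x"
  using F_eq_iff[OF assms(1,2)] assms(3) unfolding splits_mass_iff by blast

section \<open>The image of \<mu> under \<open>F\<close>\<close>

text \<open>For a pivot \<open>z\<close> at \<open>y\<close>, the set \<open>superlevel z y\<close>
  has mass \<open>measure \<nu> {a..<y}\<close> and lies, up to null sets, between
  \<open>{x. F x < y}\<close> and \<open>{x. F x \<le> y}\<close>.\<close>

lemma mu_F_less:
  assumes y: "y \<in> {a<..<b}"
  shows "measure \<mu> {x. F x < y} \<le> measure \<nu> {a..<y}"
    and "measure \<nu> {a..<y} \<le> measure \<mu> {x. F x \<le> y}"
proof -
  obtain z where z: "z \<in> X" "excess z y = 0" using pivot_exists[OF y] by metis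
  have eq: "measure \<mu> (superlevel z y) = measure \<nu> {a..<y}"
    using z by (simp add: excess_def)
  have y': "y \<in> {a..b}" using y by auto
  have "AE x in \<mu>. x \<in> {x. F x < y} \<longrightarrow> x \<in> superlevel z y"
    using AE_mu
  proof eventually_elim
    fix x assume x: "x \<in> X"
    show "x \<in> {x. F x < y} \<longrightarrow> x \<in> superlevel z y"
      using excess_less_imp[OF y', of x z] F_less_iff[OF in_closure_X[OF x] y] z x
      by (auto simp: superlevel_def)
  qed
  then show "measure \<mu> {x. F x < y} \<le> measure \<nu> {a..<y}"
    unfolding eq[symmetric] using y' by (intro mu.finite_measure_mono_AE) auto
  have "superlevel z y \<subseteq> {x. F x \<le> y}"
  proof
    fix x assume "x \<in> superlevel z y"
    then have x: "x \<in> X" "g z y < g x y" by (auto simp: superlevel_def)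
    then have "excess x y \<le> 0" using excess_mono[OF y', of z x] z by simp
    with less_F_iff[OF in_closure_X[OF x(1)] y] show "x \<in> {x. F x \<le> y}" by auto
  qed
  then show "measure \<nu> {a..<y} \<le> measure \<mu> {x. F x \<le> y}"
    unfolding eq[symmetric] by (intro mu.finite_measure_mono) auto
qed

lemma nu_atMost: "measure \<nu> {..y} = measure \<nu> {a..<y}"
proof (rule nu.finite_measure_eq_AE)
  show "AE t in \<nu>. (t \<in> {..y}) = (t \<in> {a..<y})"
    using AE_nu AE_nu_neq[of y] by eventually_elim auto
qed auto

text \<open>The distribution functions agree: the bounds of \<open>mu_F_less\<close> differ only in
  strict versus weak inequality, and letting the upper one approach from the right closes the gap
  because \<nu> has no atoms.\<close>

lemma distr_F: "distr \<mu> borel F = \<nu>"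
proof (rule cdf_unique)
  show "real_distribution (distr \<mu> borel F)"
    by (intro real_distribution.intro mu.prob_space_distr real_distribution_axioms.intro) auto
  show "real_distribution \<nu>"
    by (intro real_distribution.intro real_distribution_axioms.intro nu.prob_space_axioms) auto
  have cdf: "cdf (distr \<mu> borel F) y = measure \<mu> {x. F x \<le> y}" for y
    by (simp add: cdf_def measure_distr vimage_def)
  have upper: "measure \<mu> {x. F x \<le> y} \<le> measure \<nu> {a..<y}" if y: "y < b" for y
  proof -
    \<comment> \<open>Using \<open>max a y\<close> also covers \<open>y \<le> a\<close>, where the
      bound is zero.\<close>
    have m: "max a y < b" using y a_less_b by simp
    obtain \<eta> where \<eta>: "\<And>n::nat. \<eta> n \<in> {max a y<..<b}" and lim\<eta>: "\<eta> \<longlonglongrightarrow> max a y"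
      using right_approaching_sequence[OF m] by metis
    have "(\<lambda>n. measure \<nu> {a..<\<eta> n}) \<longlonglongrightarrow> measure \<nu> {a..<max a y}"
      using lim\<eta> by (rule nu_tendsto)
    moreover have "{a..<max a y} = {a..<y}" by auto
    ultimately have "(\<lambda>n. measure \<nu> {a..<\<eta> n}) \<longlonglongrightarrow> measure \<nu> {a..<y}" by simp
    moreover have "measure \<mu> {x. F x \<le> y} \<le> measure \<nu> {a..<\<eta> n}" for n
    proof -
      have "measure \<mu> {x. F x \<le> y} \<le> measure \<mu> {x. F x < \<eta> n}"
        using \<eta>[of n] by (intro mu.finite_measure_mono) auto
      also have "\<dots> \<le> measure \<nu> {a..<\<eta> n}" using \<eta>[of n] by (intro mu_F_less) auto
      finally show ?thesis .
    qed
    ultimately show ?thesis by (intro LIMSEQ_le_const) auto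
  qed
  show "cdf (distr \<mu> borel F) = cdf \<nu>"
  proof
    fix y
    consider "y \<le> a" | "y \<in> {a<..<b}" | "b \<le> y" by fastforce
    then show "cdf (distr \<mu> borel F) y = cdf \<nu> y"
    proof cases
      case 1
      then show ?thesis
        using upper[of y] a_less_b measure_nonneg[of \<mu> "{x. F x \<le> y}"]
        by (simp add: cdf cdf_def[of \<nu>] nu_atMost)
    next
      case 2
      then show ?thesis
        using upper[of y] mu_F_less(2)[of y] by (simp add: cdf cdf_def[of \<nu>] nu_atMost)
    next
      case 3
      have "F x \<le> y" for x using F_bounds[of x] 3 by auto
      then have "measure \<mu> {x. F x \<le> y} = 1" using mu.prob_space by simp
      moreover have "measure \<nu> {..y} = 1"
        using AE_nu 3 by (subst nu.prob_eq_1) (auto elim: eventually_mono)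
      ultimately show ?thesis by (simp add: cdf cdf_def[of \<nu>])
    qed
  qed
qed

subsection \<open>The potential and optimality\<close>

text \<open>
  The supremum may jump, because \<open>\<mu>\<close> may vanish on open sets, but it is attained and upper
  semicontinuous, hence Borel.
\<close>
definition kappa :: "real \<Rightarrow> real" where
  "kappa t = (if t \<in> {a<..<b} then Sup ((\<lambda>x. g x t) ` {x \<in> closure X. t \<le> F x}) else 0)"

text \<open>The region below the graph of \<open>F\<close>. Its slices give the attained maximum in
  \<open>kappa\<close>, its intersections with superlevel sets of \<open>g\<close> the measurability
  of \<open>kappa\<close>.\<close>

lemma F_superlevel_compact:
  "compact {z \<in> closure X \<times> {a..b}. 0 \<le> F (fst z) - snd z}"
proof -
  have "continuous_on (closure X \<times> {a..b}) (\<lambda>z. F (fst z) - snd z)"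
    by (intro continuous_intros continuous_on_compose2[OF continuous_on_F]) auto
  then have "closed ((closure X \<times> {a..b}) \<inter> (\<lambda>z. F (fst z) - snd z) -` {0..})"
    by (rule continuous_closed_preimage) (auto intro: closed_Times)
  moreover have "compact (closure X \<times> {a..b})"
    by (intro compact_Times closure_X_compact compact_Icc)
  ultimately have "compact ((closure X \<times> {a..b}) \<inter> ((closure X \<times> {a..b}) \<inter> (\<lambda>z. F (fst z) - snd z) -` {0..}))"
    by (rule compact_Int_closed[rotated])
  moreover have "(closure X \<times> {a..b}) \<inter> ((closure X \<times> {a..b}) \<inter> (\<lambda>z. F (fst z) - snd z) -` {0..})
      = {z \<in> closure X \<times> {a..b}. 0 \<le> F (fst z) - snd z}" by auto
  ultimately show ?thesis by simp
qed

lemma kappa_attained: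
  assumes t: "t \<in> {a<..<b}"
  obtains x where "x \<in> closure X" "t \<le> F x" "kappa t = g x t"
    and "\<And>x'. x' \<in> closure X \<Longrightarrow> t \<le> F x' \<Longrightarrow> g x' t \<le> kappa t"
proof -
  let ?S = "{x \<in> closure X. t \<le> F x}"
  have "compact (fst ` ({z \<in> closure X \<times> {a..b}. 0 \<le> F (fst z) - snd z} \<inter> UNIV \<times> {t}))"
    by (intro compact_continuous_image compact_Int_closed F_superlevel_compact closed_Times)
       (auto intro!: continuous_intros)
  moreover have "{z \<in> closure X \<times> {a..b}. 0 \<le> F (fst z) - snd z} \<inter> UNIV \<times> {t} = (\<lambda>x. (x, t)) ` ?S"
    using t by auto
  ultimately have "compact ?S" by (simp add: image_image)
  moreover have "?S \<noteq> {}"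
    using split_point_exists[OF t] F_eq_iff[OF _ t] by fastforce
  moreover have "continuous_on ?S (\<lambda>x. g x t)"
    using t by (intro continuous_on_subset[OF continuous_on_cost_y_fst]) auto
  ultimately obtain x where x: "x \<in> ?S" "\<And>x'. x' \<in> ?S \<Longrightarrow> g x' t \<le> g x t"
    using continuous_attains_sup[of ?S "\<lambda>x. g x t"] by blast
  then have "Sup ((\<lambda>x. g x t) ` ?S) = g x t" by (intro cSup_eq_maximum) auto
  then have "kappa t = g x t" using t by (simp add: kappa_def)
  with x show ?thesis using that by auto
qed

text \<open>The maximizer \<open>z\<close> has nonnegative excess at \<open>t\<close> while
  \<open>x\<close> has negative excess. Attainment is what makes the inequality strict.\<close>

lemma kappa_less:
  assumes x: "x \<in> closure X" and t: "t \<in> {a<..<b}" and F: "F x < t"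
  shows "kappa t < g x t"
proof -
  obtain z where z: "z \<in> closure X" "t \<le> F z" "kappa t = g z t"
    using kappa_attained[OF t] by metis
  then have "excess x t < excess z t"
    using F_less_iff[OF x t] F_less_iff[OF z(1) t] F by auto
  with z t show ?thesis by (auto intro: excess_less_imp)
qed

text \<open>A splitting point at \<open>t\<close> has \<open>F\<close> equal to \<open>t\<close>, so
  it competes in the supremum and its level already exceeds that of \<open>x\<close>.\<close>

lemma less_kappa:
  assumes x: "x \<in> closure X" and t: "t \<in> {a<..<b}" and F: "t < F x"
  shows "g x t < kappa t"
proof -
  obtain z where z: "z \<in> closure X" "excess z t = 0" using split_point_exists[OF t] by blast
  then have "g z t \<le> kappa t"
    using kappa_attained[OF t] F_eq_iff[OF _ t] by (metis order_refl)
  moreover have "g x t < g z t"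
    using less_F_iff[OF x t] F z t by (auto intro: excess_less_imp)
  ultimately show ?thesis by simp
qed

text \<open>Because the maximum is attained, the set where \<open>kappa\<close> is at least
  \<open>r\<close> is a projection of a compact set, cut to the open interval.\<close>

lemma kappa_borel [measurable]: "kappa \<in> borel_measurable borel"
proof -
  have "{t \<in> space (restrict_space borel {a<..<b}). r \<le> kappa t} \<in> sets (restrict_space borel {a<..<b})" for r
  proof -
    let ?A = "{z \<in> closure X \<times> {a..b}. 0 \<le> F (fst z) - snd z}"
    let ?B = "(closure X \<times> {a..b}) \<inter> (\<lambda>z. g (fst z) (snd z)) -` {r..}"
    have "closed ?B"
      by (rule continuous_closed_preimage[OF continuous_on_cost_y]) (auto intro: closed_Times)
    with F_superlevel_compact have "compact (?A \<inter> ?B)" by (rule compact_Int_closed)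
    then have "compact (snd ` (?A \<inter> ?B))" by (intro compact_continuous_image continuous_intros)
    then have "snd ` (?A \<inter> ?B) \<in> sets borel" by (intro borel_closed compact_imp_closed)
    moreover have "{t \<in> {a<..<b}. r \<le> kappa t} = snd ` (?A \<inter> ?B) \<inter> {a<..<b}"
    proof (intro equalityI subsetI)
      fix t assume t: "t \<in> {t \<in> {a<..<b}. r \<le> kappa t}"
      then obtain x where "x \<in> closure X" "t \<le> F x" "kappa t = g x t"
        using kappa_attained by (metis mem_Collect_eq)
      with t have "(x, t) \<in> ?A \<inter> ?B" "t = snd (x, t)" by auto
      with t show "t \<in> snd ` (?A \<inter> ?B) \<inter> {a<..<b}" by blast
    next
      fix t assume "t \<in> snd ` (?A \<inter> ?B) \<inter> {a<..<b}"
      then obtain x where "x \<in> closure X" "t \<le> F x" "r \<le> g x t" "t \<in> {a<..<b}" by auto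
      then show "t \<in> {t \<in> {a<..<b}. r \<le> kappa t}"
        using kappa_attained[of t] by (metis (mono_tags, lifting) mem_Collect_eq order_trans)
    qed
    ultimately show ?thesis
      by (simp add: sets_restrict_space_iff space_restrict_space)
  qed
  then have "kappa \<in> borel_measurable (restrict_space borel {a<..<b})"
    by (rule borel_measurable_iff_ge[THEN iffD2, rule_format])
  then have "(\<lambda>t. indicator {a<..<b} t *\<^sub>R kappa t) \<in> borel_measurable borel"
    by (subst (asm) borel_measurable_restrict_space_iff) auto
  moreover have "(\<lambda>t. indicator {a<..<b} t *\<^sub>R kappa t) = kappa"
    by (auto simp: kappa_def indicator_def)
  ultimately show ?thesis by simp
qed

lemma kappa_integrable: "integrable lborel kappa"
proof -
  have "compact ((\<lambda>z. g (fst z) (snd z)) ` (closure X \<times> {a..b}))"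
    by (intro compact_continuous_image continuous_on_cost_y compact_Times closure_X_compact compact_Icc)
  then obtain M where M: "\<And>z. z \<in> closure X \<times> {a..b} \<Longrightarrow> norm (g (fst z) (snd z)) \<le> M"
    by (meson bounded_iff compact_imp_bounded imageI)
  have "norm (kappa t) \<le> M" if t: "t \<in> {a<..<b}" for t
  proof -
    obtain x where "x \<in> closure X" "kappa t = g x t" using kappa_attained[OF t] by metis
    then show ?thesis using M[of "(x, t)"] t by simp
  qed
  then have "integrable lborel (\<lambda>t. indicator {a<..<b} t *\<^sub>R kappa t)"
    using a_less_b by (intro integrableI_bounded_set_indicator[where B = M]) auto
  moreover have "(\<lambda>t. indicator {a<..<b} t *\<^sub>R kappa t) = kappa"
    by (auto simp: kappa_def indicator_def)
  ultimately show ?thesis by simp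
qed

text \<open>As \<open>kappa\<close> vanishes off the open interval, this integrates effectively from
  \<open>a\<close>. As an integral over the whole line with \<open>y\<close> as parameter, it is
  Borel by joint measurability of the integrand.\<close>

definition K :: "real \<Rightarrow> real" where
  "K y = (LINT t|lborel. (if t \<le> y then kappa t else 0))"

lemma kappa_cut_integrable: "integrable lborel (\<lambda>t. if t \<le> y then kappa t else 0)"
  by (rule Bochner_Integration.integrable_bound[OF kappa_integrable]) auto

lemma K_borel [measurable]: "K \<in> borel_measurable borel"
  unfolding K_def by measurable

lemma K_bounded: "norm (K y) \<le> (LINT t|lborel. norm (kappa t))"
proof -
  have "norm (K y) \<le> (LINT t|lborel. norm (if t \<le> y then kappa t else 0))"
    unfolding K_def by (rule integral_norm_bound)
  also have "\<dots> \<le> (LINT t|lborel. norm (kappa t))"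
    by (intro integral_mono integrable_norm kappa_cut_integrable kappa_integrable) auto
  finally show ?thesis .
qed

lemma K_diff:
  assumes "p \<le> q"
  shows "K q - K p = (LINT t:{p..q}|lborel. kappa t)"
proof -
  have "K q - K p = (LINT t|lborel. (if t \<le> q then kappa t else 0) - (if t \<le> p then kappa t else 0))"
    unfolding K_def by (intro Bochner_Integration.integral_diff[symmetric] kappa_cut_integrable)
  also have "\<dots> = (LINT t|lborel. indicator {p..q} t *\<^sub>R kappa t)"
  proof (rule integral_cong_AE)
    show "AE t in lborel. (if t \<le> q then kappa t else 0) - (if t \<le> p then kappa t else 0)
        = indicator {p..q} t *\<^sub>R kappa t"
      \<comment> \<open>The difference of the cut-offs lives on the half-open interval and misses
        only the point \<open>p\<close>.\<close>
      using AE_lborel_singleton[of p] assms by (auto elim!: eventually_mono simp: indicator_def)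
  qed auto
  finally show ?thesis by (simp add: set_lebesgue_integral_def)
qed

lemma potential_diff:
  assumes x: "x \<in> closure X" and pq: "a \<le> p" "p \<le> q" "q \<le> b"
  shows "set_integrable lborel {p..q} (\<lambda>t. g x t - kappa t)"
    and "c (x, q) - K q - (c (x, p) - K p) = (LINT t:{p..q}|lborel. g x t - kappa t)"
proof -
  have cont: "continuous_on {p..q} (g x)"
    using pq by (intro continuous_on_subset[OF continuous_on_cost_y_snd[OF x]]) auto
  then have g: "set_integrable lborel {p..q} (g x)" by (rule borel_integrable_atLeastAtMost')
  have k: "set_integrable lborel {p..q} kappa"
    unfolding set_integrable_def by (intro integrable_mult_indicator kappa_integrable) auto
  show "set_integrable lborel {p..q} (\<lambda>t. g x t - kappa t)"
    using g k by (rule set_integral_diff)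
  have "(LINT t:{p..q}|lborel. g x t) = c (x, q) - c (x, p)"
    unfolding set_lebesgue_integral_def
  proof (rule integral_FTC_atLeastAtMost[OF pq(2) _ cont])
    fix t assume "p \<le> t" "t \<le> q"
    with has_derivative_cost[OF x, of t] pq
    have "((\<lambda>t. c (x, t)) has_vector_derivative g x t) (at t within {a..b})"
      by (simp add: has_real_derivative_iff_has_vector_derivative)
    then show "((\<lambda>t. c (x, t)) has_vector_derivative g x t) (at t within {p..q})"
      by (rule has_vector_derivative_within_subset) (use pq in auto)
  qed
  with set_integral_diff(2)[OF g k] K_diff[OF pq(2)]
  show "c (x, q) - K q - (c (x, p) - K p) = (LINT t:{p..q}|lborel. g x t - kappa t)"
    by simp
qed

text \<open>The integrand \<open>g x t - kappa t\<close> is negative before \<open>F x\<close> and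
  positive after it, so the potential difference grows in both directions away from
  \<open>F x\<close>.\<close>

lemma potential_less:
  assumes x: "x \<in> closure X" and y: "y \<in> {a..b}" "y \<noteq> F x"
  shows "c (x, F x) - K (F x) < c (x, y) - K y"
proof (cases "F x < y")
  case True
  have "0 < (LINT t:{F x..y}|lborel. g x t - kappa t)"
    using True y F_bounds[of x]
    by (intro set_lebesgue_integral_Icc_pos potential_diff(1) x) (auto intro: kappa_less[OF x])
  with potential_diff(2)[OF x, of "F x" y] True y F_bounds[of x] show ?thesis by auto
next
  case False
  with y have less: "y < F x" by simp
  have "set_integrable lborel {y..F x} (\<lambda>t. - (g x t - kappa t))"
    using less y F_bounds[of x] potential_diff(1)[OF x, of y "F x"]
    unfolding set_integrable_def scaleR_minus_right by (intro integrable_minus) auto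
  then have "0 < (LINT t:{y..F x}|lborel. - (g x t - kappa t))"
    using less y F_bounds[of x]
    by (intro set_lebesgue_integral_Icc_pos) (auto intro: less_kappa[OF x])
  moreover have "(LINT t:{y..F x}|lborel. - (g x t - kappa t)) = - (LINT t:{y..F x}|lborel. g x t - kappa t)"
    unfolding set_lebesgue_integral_def by (subst integral_minus[symmetric]) (simp add: algebra_simps)
  ultimately show ?thesis
    using potential_diff(2)[OF x, of y "F x"] less y F_bounds[of x] by auto
qed

text \<open>\<open>c\<close> is arbitrary off \<open>closure X \<times> {a..b}\<close>; cutting it off makes it bounded and Borel.\<close>
definition cbar :: "(real^2) \<times> real \<Rightarrow> real" where
  "cbar z = indicator (closure X \<times> {a..b}) z * c z"

text \<open>The gap in the dual constraint: cost minus \<open>K\<close> minus the conjugate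
  potential of \<open>x\<close>, which is the minimum over \<open>y\<close> and is attained at
  \<open>F x\<close>.\<close>

definition slack :: "(real^2) \<times> real \<Rightarrow> real" where
  "slack z = cbar z - K (snd z) - (cbar (fst z, F (fst z)) - K (F (fst z)))"

lemma cbar_borel [measurable]: "cbar \<in> borel_measurable borel"
  using borel_measurable_continuous_on_indicator[OF _ continuous_on_cost]
  by (simp add: cbar_def[abs_def] borel_closed closed_Times)

lemma cbar_bounded:
  obtains M where "\<And>z. norm (cbar z) \<le> M"
proof -
  have "compact (c ` (closure X \<times> {a..b}))"
    by (intro compact_continuous_image continuous_on_cost compact_Times closure_X_compact compact_Icc)
  from compact_imp_bounded[OF this]
  obtain M where "M > 0" "\<forall>y\<in>c ` (closure X \<times> {a..b}). norm y \<le> M"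
    unfolding bounded_pos by blast
  then have "norm (cbar z) \<le> M" for z by (auto simp: cbar_def indicator_def less_imp_le)
  then show ?thesis using that by blast
qed

lemma slack_pos:
  assumes "z \<in> closure X \<times> {a..b}"
  shows "0 \<le> slack z" and "slack z = 0 \<Longrightarrow> snd z = F (fst z)"
  using potential_less[of "fst z" "snd z"] assms F_bounds[of "fst z"]
  by (cases "snd z = F (fst z)"; force simp: slack_def cbar_def)+

end

section \<open>Cost of an arbitrary plan\<close>

locale transport_plan = split_transport + prob_space \<gamma>
  for \<gamma> :: "((real^2) \<times> real) measure" +
  assumes sets_plan [measurable_cong, simp]: "sets \<gamma> = sets borel"
    and fst_marginal: "distr \<gamma> borel fst = \<mu>" and snd_marginal: "distr \<gamma> borel snd = \<nu>"
begin

lemma fst_measurable_plan [measurable]: "fst \<in> borel_measurable \<gamma>"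
  and snd_measurable_plan [measurable]: "snd \<in> borel_measurable \<gamma>"
  by (simp_all add: measurable_cong_sets[OF sets_plan refl] borel_measurable_continuous_onI continuous_on_fst continuous_on_snd)

lemma AE_plan: "AE z in \<gamma>. z \<in> X \<times> {a<..<b}"
proof -
  have "AE z in \<gamma>. fst z \<in> X"
    using AE_mu unfolding fst_marginal[symmetric] by (rule AE_distrD[rotated]) measurable
  moreover have "AE z in \<gamma>. snd z \<in> {a<..<b}"
    using AE_nu unfolding snd_marginal[symmetric] by (rule AE_distrD[rotated]) measurable
  ultimately show ?thesis by eventually_elim (simp add: mem_Times_iff)
qed

lemma AE_slack_nonneg: "AE z in \<gamma>. 0 \<le> slack z"
  using AE_plan
proof eventually_elim
  case (elim z)
  then show ?case using in_closure_X by (intro slack_pos) (auto simp: mem_Times_iff less_imp_le)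
qed

lemma integral_cost: "(LINT z:(X \<times> {a<..<b})|\<gamma>. c z) = (LINT z|\<gamma>. cbar z)"
  unfolding set_lebesgue_integral_def
proof (rule integral_cong_AE)
  show *: "AE z in \<gamma>. indicator (X \<times> {a<..<b}) z *\<^sub>R c z = cbar z"
    using AE_plan
  proof eventually_elim
    case (elim z)
    then show ?case using in_closure_X by (auto simp: cbar_def indicator_def)
  qed
  have "continuous_on (X \<times> {a<..<b}) c"
    using in_closure_X by (intro continuous_on_subset[OF continuous_on_cost]) auto
  then show "(\<lambda>z. indicator (X \<times> {a<..<b}) z *\<^sub>R c z) \<in> borel_measurable \<gamma>"
    unfolding measurable_cong_sets[OF sets_plan refl]
    using open_X by (intro borel_measurable_continuous_on_indicator borel_open open_Times) auto
qed simp

lemma integral_fst_marginal: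
  fixes f :: "real^2 \<Rightarrow> real"
  assumes "f \<in> borel_measurable borel"
  shows "(LINT z|\<gamma>. f (fst z)) = (LINT x|\<mu>. f x)"
  using integral_distr[OF fst_measurable_plan assms] by (simp add: fst_marginal)

lemma integral_snd_marginal:
  fixes f :: "real \<Rightarrow> real"
  assumes "f \<in> borel_measurable borel"
  shows "(LINT z|\<gamma>. f (snd z)) = (LINT y|\<nu>. f y)"
  using integral_distr[OF snd_measurable_plan assms] by (simp add: snd_marginal)

text \<open>The two \<open>K\<close> terms cancel because \<open>snd\<close> and \<open>F\<close>
  composed with \<open>fst\<close> both have distribution \<nu>. What remains says that a plan costs
  more than \<open>F\<close> by exactly its integrated slack.\<close>

lemma integral_slack:
  shows "integrable \<gamma> slack"
    and "(LINT z|\<gamma>. cbar z) = (LINT z|\<gamma>. slack z) + (LINT x|\<mu>. cbar (x, F x))"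
proof -
  obtain M where M: "\<And>z. norm (cbar z) \<le> M" using cbar_bounded by metis
  have m: "(\<lambda>z. cbar (fst z, F (fst z))) \<in> borel_measurable \<gamma>"
    "(\<lambda>x. cbar (x, F x)) \<in> borel_measurable borel"
    by measurable
  have int: "integrable \<gamma> cbar" "integrable \<gamma> (\<lambda>z. K (snd z))"
    "integrable \<gamma> (\<lambda>z. cbar (fst z, F (fst z)))" "integrable \<gamma> (\<lambda>z. K (F (fst z)))"
    using m by (auto intro!: integrable_const_bound AE_I2 M K_bounded)
  show "integrable \<gamma> slack"
    unfolding slack_def by (intro Bochner_Integration.integrable_diff int)
  have 1: "(LINT z|\<gamma>. K (snd z)) = (LINT y|\<nu>. K y)"
    by (rule integral_snd_marginal) measurable
  have 2: "(LINT z|\<gamma>. cbar (fst z, F (fst z))) = (LINT x|\<mu>. cbar (x, F x))"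
    using m(2) by (rule integral_fst_marginal)
  have "(LINT z|\<gamma>. K (F (fst z))) = (LINT x|\<mu>. K (F x))"
    by (rule integral_fst_marginal) measurable
  also have "\<dots> = (LINT y|\<nu>. K y)"
    using integral_distr[of F \<mu> borel K] by (simp add: distr_F)
  finally show "(LINT z|\<gamma>. cbar z) = (LINT z|\<gamma>. slack z) + (LINT x|\<mu>. cbar (x, F x))"
    unfolding slack_def using 1 2 by (simp add: int)
qed

end

section \<open>Optimality of \<open>F\<close> and supports of optimal plans\<close>

context split_transport begin

text \<open>The plan carried by the graph of \<open>G\<close> reduces comparisons between maps to
  comparisons between plans.\<close>

lemma transport_plan_of_map:
  assumes "G \<in> borel_measurable borel" "distr \<mu> borel G = \<nu>"
  shows "transport_plan X a b c \<mu> \<nu> (distr \<mu> borel (\<lambda>x. (x, G x)))"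
    and "(LINT z|distr \<mu> borel (\<lambda>x. (x, G x)). cbar z) = (LINT x|\<mu>. cbar (x, G x))"
proof -
  note [measurable] = assms(1)
  have m: "(\<lambda>x. (x, G x)) \<in> measurable \<mu> borel" by measurable
  have fs: "fst \<in> borel_measurable (borel :: ((real^2) \<times> real) measure)"
    "snd \<in> borel_measurable (borel :: ((real^2) \<times> real) measure)"
    by (intro borel_measurable_continuous_onI continuous_intros)+
  have "distr \<mu> borel (\<lambda>x. x) = \<mu>" by (rule distr_id2) simp
  with assms(2) show "transport_plan X a b c \<mu> \<nu> (distr \<mu> borel (\<lambda>x. (x, G x)))"
    by (intro transport_plan.intro split_transport_axioms transport_plan_axioms.intro mu.prob_space_distr m)
       (simp_all add: distr_distr[OF fs(1) m] distr_distr[OF fs(2) m] comp_def)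
  show "(LINT z|distr \<mu> borel (\<lambda>x. (x, G x)). cbar z) = (LINT x|\<mu>. cbar (x, G x))"
    by (rule integral_distr[OF m]) measurable
qed

lemma F_transport_map: "F \<in> transport_maps X a b \<mu> \<nu>"
  using F_bounds by (auto simp: transport_maps_def distr_F)

lemma integral_cost_map:
  assumes "G \<in> transport_maps X a b \<mu> \<nu>"
  shows "(LINT x:X|\<mu>. c (x, G x)) = (LINT x|\<mu>. cbar (x, G x))"
proof -
  have G[measurable]: "G \<in> borel_measurable borel" and "\<And>x. x \<in> X \<Longrightarrow> G x \<in> {a..b}"
    using assms by (auto simp: transport_maps_def)
  then have "(LINT x:X|\<mu>. c (x, G x)) = (LINT x|\<mu>. indicator X x *\<^sub>R cbar (x, G x))"
    unfolding set_lebesgue_integral_def cbar_def using in_closure_X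
    by (intro Bochner_Integration.integral_cong) (auto simp: indicator_def)
  also have "\<dots> = (LINT x|\<mu>. cbar (x, G x))"
    using AE_mu by (intro integral_cong_AE) (measurable, auto elim!: eventually_mono)
  finally show ?thesis .
qed

lemma F_monge_optimal: "monge_optimal X a b c \<mu> \<nu> F"
  unfolding monge_optimal_def
proof (intro conjI ballI F_transport_map)
  fix G assume G: "G \<in> transport_maps X a b \<mu> \<nu>"
  then interpret plan: transport_plan X a b c \<mu> \<nu> "distr \<mu> borel (\<lambda>x. (x, G x))"
    by (intro transport_plan_of_map) (auto simp: transport_maps_def)
  have "(LINT x|\<mu>. cbar (x, F x)) \<le> (LINT z|distr \<mu> borel (\<lambda>x. (x, G x)). cbar z)"
    using plan.integral_slack(2) integral_nonneg_AE[OF plan.AE_slack_nonneg] by simp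
  also have "\<dots> = (LINT x|\<mu>. cbar (x, G x))"
    using G by (intro transport_plan_of_map) (auto simp: transport_maps_def)
  finally show "(LINT x:X|\<mu>. c (x, F x)) \<le> (LINT x:X|\<mu>. c (x, G x))"
    by (simp add: integral_cost_map G F_transport_map)
qed

lemma coupling_iff_transport_plan:
  "\<gamma> \<in> couplings X a b \<mu> \<nu> \<longleftrightarrow> transport_plan X a b c \<mu> \<nu> \<gamma>"
proof
  assume "\<gamma> \<in> couplings X a b \<mu> \<nu>"
  then show "transport_plan X a b c \<mu> \<nu> \<gamma>"
    by (auto simp: couplings_def borel_prob_on_def transport_plan_def transport_plan_axioms_def
        split_transport_axioms)
next
  assume "transport_plan X a b c \<mu> \<nu> \<gamma>"
  then interpret plan: transport_plan X a b c \<mu> \<nu> \<gamma> .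
  have "X \<times> {a<..<b} \<in> sets \<gamma>" using open_X by (auto intro!: borel_open open_Times)
  then have "emeasure \<gamma> (X \<times> {a<..<b}) = 1"
    using plan.AE_plan by (simp add: plan.emeasure_eq_1_AE)
  then show "\<gamma> \<in> couplings X a b \<mu> \<nu>"
    by (simp add: couplings_def borel_prob_on_def plan.prob_space_axioms plan.fst_marginal plan.snd_marginal)
qed

text \<open>Comparison with the plan of \<open>F\<close> forces the slack to vanish almost
  everywhere, so \<gamma> is concentrated on the graph of \<open>F\<close>.\<close>

lemma kantorovich_solution_support:
  assumes sol: "kantorovich_solution X a b c \<mu> \<nu> \<gamma>" and xy: "(x, y) \<in> spt \<gamma>"
  shows "y = F x"
proof -
  interpret plan: transport_plan X a b c \<mu> \<nu> \<gamma>
    using sol by (simp add: kantorovich_solution_def coupling_iff_transport_plan)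
  let ?\<gamma>F = "distr \<mu> borel (\<lambda>x. (x, F x))"
  interpret planF: transport_plan X a b c \<mu> \<nu> ?\<gamma>F
    by (intro transport_plan_of_map F_borel distr_F)
  have "(LINT z|\<gamma>. cbar z) \<le> (LINT z|?\<gamma>F. cbar z)"
    using sol planF.transport_plan_axioms
    by (simp add: kantorovich_solution_def coupling_iff_transport_plan
        flip: plan.integral_cost planF.integral_cost)
  also have "\<dots> = (LINT x|\<mu>. cbar (x, F x))"
    by (intro transport_plan_of_map F_borel distr_F)
  finally have "(LINT z|\<gamma>. slack z) = 0"
    using plan.integral_slack(2) integral_nonneg_AE[OF plan.AE_slack_nonneg] by simp
  then have "AE z in \<gamma>. slack z = 0"
    using integral_nonneg_eq_0_iff_AE[OF plan.integral_slack(1) plan.AE_slack_nonneg] by simp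
  \<comment> \<open>The graph of \<open>F\<close> over \<open>closure X\<close>. Continuity of
    \<open>F\<close> makes it closed, so full mass already puts the support inside it.\<close>
  let ?S = "{z \<in> closure X \<times> {a..b}. F (fst z) - snd z = 0}"
  have "continuous_on (closure X \<times> {a..b}) (\<lambda>z. F (fst z) - snd z)"
    by (intro continuous_intros continuous_on_compose2[OF continuous_on_F]) auto
  then have closed: "closed ?S"
    by (rule continuous_closed_preimage_constant) (auto intro: closed_Times)
  have "AE z in \<gamma>. z \<in> ?S"
    using \<open>AE z in \<gamma>. slack z = 0\<close> plan.AE_plan
  proof eventually_elim
    case (elim z)
    then have "z \<in> closure X \<times> {a..b}" using in_closure_X by (auto simp: mem_Times_iff)
    with slack_pos(2)[OF this] elim show ?case by auto
  qed
  then have "emeasure \<gamma> ?S = 1"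
    using closed by (subst plan.emeasure_eq_1_AE) (auto simp: borel_closed)
  then have "spt \<gamma> \<subseteq> ?S"
    using closed by (auto simp: spt_def plan.emeasure_space_1)
  with xy show ?thesis by auto
qed

lemma optimal_map_F: "optimal_map_on_closure X a b c \<mu> \<nu> F"
  unfolding optimal_map_on_closure_def
  using F_monge_optimal F_bounds F_splits_mass split_unique kantorovich_solution_support by blast

end

theorem corollary4p9:
  fixes X :: "(real^2) set" and a b :: real and c :: "(real^2) \<times> real \<Rightarrow> real"
    and \<mu> :: "(real^2) measure" and \<nu> :: "real measure"
  assumes "open X" "connected X" "X \<noteq> {}" "bounded X"
    and "a < b"
    and "C2_closure (X \<times> {a<..<b}) c"
    and "\<forall>x\<in>X. \<forall>y\<in>{a<..<b}. \<exists>D. (GDERIV (\<lambda>x'. cost_y a b c x' y) x :> D) \<and> D \<noteq> 0"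
    and "borel_prob_on X \<mu>" "absolutely_continuous lborel \<mu>"
    and "borel_prob_on {a<..<b} \<nu>" "absolutely_continuous lborel \<nu>"
    and "\<forall>x\<in>closure X. \<forall>y\<in>closure {a<..<b}. splits_mass X a b c \<mu> \<nu> x y \<longrightarrow>
           (\<exists>xt\<in>P_set X a b c \<inter> level_set X a b c x y. mass_comparison X a b c \<mu> \<nu> xt)"
  shows "\<exists>F. optimal_map_on_closure X a b c \<mu> \<nu> F \<and> continuous_on (closure X) F"
proof -
  interpret split_transport X a b c \<mu> \<nu>
    using assms by (rule split_transport.intro)
  show ?thesis using optimal_map_F continuous_on_F by blast
qed

end
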